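(* Let $\mathcal{L}$ be a subspace lattice on a complex Banach space $X$ and let $\mathcal{A}=\mathrm{alg}\,\mathcal{L}$. If there exists a non-trivial idempotent $P\in\mathcal{A}$ such that $\mathrm{ran}(P)\in\mathcal{L}$ and $PB(X)(I-P)\subseteq\mathcal{A}$, then every $C\in\mathcal{A}$ is a Jordan higher all-derivable point.
   Context: $B(X)$ is the algebra of all bounded linear operators on $X$. A subspace lattice on $X$ is a collection $\mathcal{L}$ of closed subspaces of $X$ with $(0),X\in\mathcal{L}$ such that for every family $\{M_r\}$ of elements of $\mathcal{L}$, both the intersection $\cap M_r$ and the closed linear span $\vee M_r$ belong to $\mathcal{L}$. $\mathrm{alg}\,\mathcal{L}$ is the algebra of all operators in $B(X)$ that leave every member of $\mathcal{L}$ invariant. A non-trivial idempotent is one different from $0$ and $I$. $L(\mathcal{A})$ is the set of all (not necessarily bounded) linear mappings from $\mathcal{A}$ to $\mathcal{A}$; $\mathbb{N}$ is the set of non-negative integers; $I_{\mathcal{A}}$ is the identity mapping on $\mathcal{A}$. A sequence $\{d_i\}_{i\in\mathbb{N}}$ in $L(\mathcal{A})$ with $d_0=I_{\mathcal{A}}$ is a Jordan higher derivation if $d_n(AB+BA)=\sum_{i+j=n}(d_i(A)d_j(B)+d_i(B)d_j(A))$ for all $n\in\mathbb{N}$ and all $A,B\in\mathcal{A}$; it is Jordan higher derivable at $C\in\mathcal{A}$ if this identity holds for all $n\in\mathbb{N}$ and all $A,B\in\mathcal{A}$ with $AB=C$. An element $C\in\mathcal{A}$ is a Jordan higher all-derivable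 point if every sequence in $L(\mathcal{A})$ with $d_0=I_{\mathcal{A}}$ that is Jordan higher derivable at $C$ is a Jordan higher derivation. *)

theory Defs
  imports "HOL-Analysis.Analysis"
begin

(* Complex normed spaces are layered on top of the real ones: the complex scalar multiplication
   extends the real one, so topology, completeness and blinfun can be reused. *)

class complex_vector = real_vector +
  fixes scaleC :: "complex \<Rightarrow> 'a \<Rightarrow> 'a"  (infixr "*\<^sub>C" 75)
  assumes scaleC_add_right: "a *\<^sub>C (x + y) = a *\<^sub>C x + a *\<^sub>C y"
    and scaleC_add_left: "(a + b) *\<^sub>C x = a *\<^sub>C x + b *\<^sub>C x"
    and scaleC_scaleC: "a *\<^sub>C b *\<^sub>C x = (a * b) *\<^sub>C x"
    and scaleC_of_real: "complex_of_real r *\<^sub>C x = r *\<^sub>R x"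

class complex_normed_vector = complex_vector + real_normed_vector +
  assumes norm_scaleC: "norm (a *\<^sub>C x) = cmod a * norm x"

class complex_banach = complex_normed_vector + banach

lemma scaleC_one [simp]: "1 *\<^sub>C x = (x :: 'a::complex_vector)"
  using scaleC_of_real[of 1 x] by simp

global_interpretation complex_vector:
  vector_space "scaleC :: complex \<Rightarrow> 'a \<Rightarrow> 'a::complex_vector"
  by unfold_locales (simp_all add: scaleC_add_right scaleC_add_left scaleC_scaleC)

lemma bounded_linear_scaleC_right:
  "bounded_linear (\<lambda>x. c *\<^sub>C (x :: 'a::complex_normed_vector))"
proof (rule bounded_linear_intro[where K = "cmod c"])
  fix r :: real and x :: 'a
  show "c *\<^sub>C r *\<^sub>R x = r *\<^sub>R c *\<^sub>C x"
    by (simp flip: scaleC_of_real add: scaleC_scaleC mult.commute)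
qed (simp_all add: scaleC_add_right norm_scaleC mult.commute)

instantiation blinfun :: (real_normed_vector, complex_normed_vector) complex_vector
begin

lift_definition scaleC_blinfun :: "complex \<Rightarrow> 'a \<Rightarrow>\<^sub>L 'b \<Rightarrow> 'a \<Rightarrow>\<^sub>L 'b"
  is "\<lambda>c f x. c *\<^sub>C f x"
  by (rule bounded_linear_compose[OF bounded_linear_scaleC_right])

instance
  by standard
    (transfer, simp add: scaleC_add_right scaleC_add_left scaleC_scaleC scaleC_of_real)+

end

(* B(X): blinfun only provides real-linearity, so complex homogeneity is imposed. *)
definition bounded_operators :: "('a::complex_normed_vector \<Rightarrow>\<^sub>L 'a) set" where
  "bounded_operators = {T. \<forall>c x. blinfun_apply T (c *\<^sub>C x) = c *\<^sub>C blinfun_apply T x}"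

definition subspace_lattice :: "'a::complex_normed_vector set set \<Rightarrow> bool" where
  "subspace_lattice L \<longleftrightarrow>
     (\<forall>M\<in>L. complex_vector.subspace M \<and> closed M) \<and> {0} \<in> L \<and> UNIV \<in> L \<and>
     (\<forall>F\<subseteq>L. \<Inter>F \<in> L \<and> closure (complex_vector.span (\<Union>F)) \<in> L)"

definition alg :: "'a::complex_normed_vector set set \<Rightarrow> ('a \<Rightarrow>\<^sub>L 'a) set" where
  "alg L = {T \<in> bounded_operators. \<forall>M\<in>L. blinfun_apply T ` M \<subseteq> M}"

(* L(A), for an algebra A of operators. The maps are total HOL functions; only their
   values on A are relevant. *)
definition linear_maps ::
  "('a::complex_normed_vector \<Rightarrow>\<^sub>L 'a) set \<Rightarrow> (('a \<Rightarrow>\<^sub>L 'a) \<Rightarrow> ('a \<Rightarrow>\<^sub>L 'a)) set" where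
  "linear_maps \<A> = {f. (\<forall>A\<in>\<A>. f A \<in> \<A>) \<and>
     (\<forall>A\<in>\<A>. \<forall>B\<in>\<A>. f (A + B) = f A + f B) \<and> (\<forall>c. \<forall>A\<in>\<A>. f (c *\<^sub>C A) = c *\<^sub>C f A)}"

definition higher_sequence ::
  "('a::complex_normed_vector \<Rightarrow>\<^sub>L 'a) set \<Rightarrow> (nat \<Rightarrow> ('a \<Rightarrow>\<^sub>L 'a) \<Rightarrow> ('a \<Rightarrow>\<^sub>L 'a)) \<Rightarrow> bool" where
  "higher_sequence \<A> d \<longleftrightarrow> (\<forall>n. d n \<in> linear_maps \<A>) \<and> (\<forall>A\<in>\<A>. d 0 A = A)"

definition jordan_higher_identity ::
  "(nat \<Rightarrow> ('a::complex_normed_vector \<Rightarrow>\<^sub>L 'a) \<Rightarrow> ('a \<Rightarrow>\<^sub>L 'a)) \<Rightarrow> 'a \<Rightarrow>\<^sub>L 'a \<Rightarrow> 'a \<Rightarrow>\<^sub>L 'a \<Rightarrow> bool" where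
  "jordan_higher_identity d A B \<longleftrightarrow>
     (\<forall>n. d n ((A o\<^sub>L B) + (B o\<^sub>L A)) =
        (\<Sum>(i, j) | i + j = n. (d i A o\<^sub>L d j B) + (d i B o\<^sub>L d j A)))"

definition jordan_higher_derivation ::
  "('a::complex_normed_vector \<Rightarrow>\<^sub>L 'a) set \<Rightarrow> (nat \<Rightarrow> ('a \<Rightarrow>\<^sub>L 'a) \<Rightarrow> ('a \<Rightarrow>\<^sub>L 'a)) \<Rightarrow> bool" where
  "jordan_higher_derivation \<A> d \<longleftrightarrow>
     higher_sequence \<A> d \<and> (\<forall>A\<in>\<A>. \<forall>B\<in>\<A>. jordan_higher_identity d A B)"

definition jordan_higher_derivable_at ::
  "('a::complex_normed_vector \<Rightarrow>\<^sub>L 'a) set \<Rightarrow> (nat \<Rightarrow> ('a \<Rightarrow>\<^sub>L 'a) \<Rightarrow> ('a \<Rightarrow>\<^sub>L 'a)) \<Rightarrow> 'a \<Rightarrow>\<^sub>L 'a \<Rightarrow> bool" where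
  "jordan_higher_derivable_at \<A> d C \<longleftrightarrow>
     higher_sequence \<A> d \<and> (\<forall>A\<in>\<A>. \<forall>B\<in>\<A>. A o\<^sub>L B = C \<longrightarrow> jordan_higher_identity d A B)"

definition jordan_higher_all_derivable_point ::
  "('a::complex_normed_vector \<Rightarrow>\<^sub>L 'a) set \<Rightarrow> 'a \<Rightarrow>\<^sub>L 'a \<Rightarrow> bool" where
  "jordan_higher_all_derivable_point \<A> C \<longleftrightarrow>
     C \<in> \<A> \<and> (\<forall>d. jordan_higher_derivable_at \<A> d C \<longrightarrow> jordan_higher_derivation \<A> d)"

definition nontrivial_idempotent :: "('a::real_normed_vector \<Rightarrow>\<^sub>L 'a) \<Rightarrow> bool" where
  "nontrivial_idempotent P \<longleftrightarrow> P o\<^sub>L P = P \<and> P \<noteq> 0 \<and> P \<noteq> id_blinfun"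

end

theory Submission
  imports Defs
begin

text \<open>Write \<open>q = 1 - P\<close> and split \<open>\<A> = alg \<L>\<close> into the corners \<open>P\<A>P\<close>, \<open>M = P\<A>q = P B(X) q\<close> and \<open>q\<A>q\<close>.
  For invertible \<open>a \<in> P\<A>P\<close>, \<open>b \<in> q\<A>q\<close> and any \<open>s \<in> M\<close>, every \<open>C \<in> \<A>\<close> factors as
  \<open>(a + s + q C b\<^sup>-\<^sup>1) (a\<^sup>-\<^sup>1 (C - s b) + b)\<close>.  Rescaling \<open>a\<close>, \<open>b\<close>, \<open>s\<close> by real numbers and
  comparing coefficients shows that the defect \<open>\<phi>\<close> of a map that is Jordan derivable at \<open>C\<close> satisfies
  \<open>\<phi> a b = 0\<close> and \<open>\<phi> (a s) b = \<phi> a (s b)\<close>.  After subtracting an inner derivation these relations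
  force the map to be a derivation, because \<open>M\<close> is faithful on both sides and its bimodule
  endomorphisms are scalars; the latter facts come from rank-one operators, hence from the
  Hahn--Banach theorem.  A higher sequence is reduced to this first-order statement through its
  logarithmic derivative.\<close>

section \<open>Jordan derivable maps on triangular algebras\<close>

text \<open>\<open>J\<close> is left arbitrary: the corner analysis uses the Jordan product of an
  associative algebra, while the reduction of higher sequences is phrased for any bilinear
  product.\<close>

definition jordan_defect :: "('r::real_vector \<Rightarrow> 'r \<Rightarrow> 'r) \<Rightarrow> ('r \<Rightarrow> 'r) \<Rightarrow> 'r \<Rightarrow> 'r \<Rightarrow> 'r" where
  "jordan_defect J \<delta> x y = \<delta> (J x y) - J (\<delta> x) y - J x (\<delta> y)"

lemma bilinear_jordan_defect:
  assumes "bilinear J" "linear \<delta>"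
  shows "bilinear (jordan_defect J \<delta>)"
  unfolding bilinear_def linear_iff jordan_defect_def
  by (simp add: bilinear_ladd[OF assms(1)] bilinear_radd[OF assms(1)] bilinear_lmul[OF assms(1)]
      bilinear_rmul[OF assms(1)] linear_add[OF assms(2)] linear_cmul[OF assms(2)] algebra_simps)

text \<open>These are the values of u + t v + t^(-1) w at t = 1, -1, 2; they determine the three
  coefficients.\<close>

lemma odd_laurent_coeff_zero:
  fixes u v w :: "'b::real_vector"
  assumes "u + v + w = 0" "u - v - w = 0" "u + 2 *\<^sub>R v + (1/2) *\<^sub>R w = 0"
  shows "u = 0" "v = 0" "w = 0"
proof -
  have "2 *\<^sub>R (v + w) = (u + v + w) - (u - v - w)"
    by (simp add: scaleR_2)
  then have "v + w = 0" using assms by simp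
  then have w: "w = - v" and u: "u = 0" using assms(1) by (simp_all add: add_eq_0_iff add.assoc)
  have "(2 - 1/2) *\<^sub>R v = u + 2 *\<^sub>R v + (1/2) *\<^sub>R w"
    unfolding scaleR_left_diff_distrib by (simp add: u w)
  then show "v = 0" using assms(3) by simp
  then show "w = 0" "u = 0" using w u by simp_all
qed

lemma double_eq_0: "x + x = 0 \<longleftrightarrow> x = (0::'b::real_vector)"
  by (simp flip: scaleR_2)

text \<open>\<open>torsion_free\<close> is the form in which it is used that \<open>a s = s b\<close> for all \<open>s\<close> makes \<open>a\<close> a (complex)
  scalar.  Only the real structure of the algebra enters.\<close>

locale triangular_algebra =
  fixes mul :: "'r::real_vector \<Rightarrow> 'r \<Rightarrow> 'r"  (infixl "\<odot>" 70)
    and A :: "'r set" and e p :: 'r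
    and A11 A12 A22 :: "'r set"
  defines "A11 \<equiv> {x \<in> A. p \<odot> x = x \<and> x \<odot> p = x}"
    and "A12 \<equiv> {x \<in> A. p \<odot> x = x \<and> x \<odot> p = 0}"
    and "A22 \<equiv> {x \<in> A. p \<odot> x = 0 \<and> x \<odot> p = 0}"
  assumes bilinear: "bilinear (\<odot>)"
    and assoc: "x \<odot> y \<odot> z = x \<odot> (y \<odot> z)"
    and subspace: "subspace A"
    and mul_closed: "x \<in> A \<Longrightarrow> y \<in> A \<Longrightarrow> x \<odot> y \<in> A"
    and unit_mem: "e \<in> A" and unit_left: "e \<odot> x = x" and unit_right: "x \<odot> e = x"
    and p_mem: "p \<in> A" and p_idem: "p \<odot> p = p" and p_nonzero: "p \<noteq> 0"
    and triangular: "x \<in> A \<Longrightarrow> p \<odot> (x \<odot> p) = x \<odot> p"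
    and resolvent: "x \<in> A \<Longrightarrow> \<exists>r. \<exists>y\<in>A. (r *\<^sub>R e - x) \<odot> y = e \<and> y \<odot> (r *\<^sub>R e - x) = e"
    and faithful_left: "a \<in> A11 \<Longrightarrow> (\<And>s. s \<in> A12 \<Longrightarrow> a \<odot> s = 0) \<Longrightarrow> a = 0"
    and faithful_right: "b \<in> A22 \<Longrightarrow> (\<And>s. s \<in> A12 \<Longrightarrow> s \<odot> b = 0) \<Longrightarrow> b = 0"
    and torsion_free: "a \<in> A11 \<Longrightarrow> b \<in> A22 \<Longrightarrow> (\<And>s. s \<in> A12 \<Longrightarrow> a \<odot> s = s \<odot> b) \<Longrightarrow>
      t \<in> A12 \<Longrightarrow> a \<odot> t = 0 \<Longrightarrow> t \<noteq> 0 \<Longrightarrow> a = 0"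
begin

definition jprod :: "'r \<Rightarrow> 'r \<Rightarrow> 'r"  (infixl "\<bullet>\<^sub>J" 70) where
  "x \<bullet>\<^sub>J y = x \<odot> y + y \<odot> x"

lemma bilinear_jprod: "bilinear (\<bullet>\<^sub>J)"
  unfolding bilinear_def linear_iff jprod_def
  by (simp add: bilinear_ladd[OF bilinear] bilinear_radd[OF bilinear] bilinear_lmul[OF bilinear]
      bilinear_rmul[OF bilinear] algebra_simps)

lemmas mul_simps = bilinear_ladd[OF bilinear] bilinear_radd[OF bilinear]
  bilinear_lsub[OF bilinear] bilinear_rsub[OF bilinear]
  bilinear_lneg[OF bilinear] bilinear_rneg[OF bilinear]
  bilinear_lmul[OF bilinear] bilinear_rmul[OF bilinear]
  bilinear_lzero[OF bilinear] bilinear_rzero[OF bilinear]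
  assoc unit_left unit_right p_idem

lemma p_idem': "p \<odot> (p \<odot> x) = p \<odot> x"
  by (simp add: p_idem flip: assoc)

lemmas mem_simps = subspace_add[OF subspace] subspace_diff[OF subspace] subspace_scale[OF subspace]
  subspace_neg[OF subspace] subspace_0[OF subspace] mul_closed unit_mem p_mem

section \<open>Peirce calculus of the three corners\<close>

lemma mul_zero1: "x \<odot> p = 0 \<Longrightarrow> p \<odot> y = y \<Longrightarrow> x \<odot> y = 0"
  by (metis assoc bilinear_lzero[OF bilinear])

lemma mul_zero2: "x \<odot> p = x \<Longrightarrow> p \<odot> y = 0 \<Longrightarrow> x \<odot> y = 0"
  by (metis assoc bilinear_rzero[OF bilinear])

lemma cornerI:
  "x \<in> A \<Longrightarrow> p \<odot> x = x \<Longrightarrow> x \<odot> p = x \<Longrightarrow> x \<in> A11"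
  "x \<in> A \<Longrightarrow> p \<odot> x = x \<Longrightarrow> x \<odot> p = 0 \<Longrightarrow> x \<in> A12"
  "x \<in> A \<Longrightarrow> p \<odot> x = 0 \<Longrightarrow> x \<odot> p = 0 \<Longrightarrow> x \<in> A22"
  by (simp_all add: A11_def A12_def A22_def)

lemma corner_zero:
  "s \<in> A12 \<Longrightarrow> a \<in> A11 \<Longrightarrow> s \<odot> a = 0"
  "s \<in> A12 \<Longrightarrow> t \<in> A12 \<Longrightarrow> s \<odot> t = 0"
  "b \<in> A22 \<Longrightarrow> a \<in> A11 \<Longrightarrow> b \<odot> a = 0"
  "b \<in> A22 \<Longrightarrow> s \<in> A12 \<Longrightarrow> b \<odot> s = 0"
  "a \<in> A11 \<Longrightarrow> b \<in> A22 \<Longrightarrow> a \<odot> b = 0"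
  by (auto simp: A11_def A12_def A22_def intro: mul_zero1 mul_zero2)

lemma corner_closed:
  "a \<in> A11 \<Longrightarrow> a' \<in> A11 \<Longrightarrow> a \<odot> a' \<in> A11"
  "a \<in> A11 \<Longrightarrow> s \<in> A12 \<Longrightarrow> a \<odot> s \<in> A12"
  "s \<in> A12 \<Longrightarrow> b \<in> A22 \<Longrightarrow> s \<odot> b \<in> A12"
  "b \<in> A22 \<Longrightarrow> b' \<in> A22 \<Longrightarrow> b \<odot> b' \<in> A22"
  by (auto simp: A11_def A12_def A22_def mul_closed mul_simps) (simp_all flip: assoc add: mul_simps(9,10))

lemma corner_units: "p \<in> A11" "e - p \<in> A22"
  by (auto simp: A11_def A22_def mul_simps mem_simps)

lemma corner_unit_simps:
  "a \<in> A11 \<Longrightarrow> p \<odot> a = a" "a \<in> A11 \<Longrightarrow> a \<odot> p = a"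
  "s \<in> A12 \<Longrightarrow> p \<odot> s = s" "s \<in> A12 \<Longrightarrow> s \<odot> p = 0"
  "b \<in> A22 \<Longrightarrow> p \<odot> b = 0" "b \<in> A22 \<Longrightarrow> b \<odot> p = 0"
  by (auto simp: A11_def A12_def A22_def)

lemma corner_subset: "x \<in> A11 \<Longrightarrow> x \<in> A" "x \<in> A12 \<Longrightarrow> x \<in> A" "x \<in> A22 \<Longrightarrow> x \<in> A"
  by (auto simp: A11_def A12_def A22_def)

lemma corner_subspace: "subspace A11" "subspace A12" "subspace A22"
  by (auto simp: subspace_def A11_def A12_def A22_def mul_simps mem_simps)

text \<open>With q = \<open>e - p\<close>, \<open>triangular\<close> says q x p = 0. So
  \<open>x \<odot> p\<close> is already p x p and \<open>x - p \<odot> x\<close> is already q x q,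
  and only three Peirce components remain.\<close>

lemma corner_decompose:
  assumes "x \<in> A"
  obtains a s b where "a \<in> A11" "s \<in> A12" "b \<in> A22" "x = a + s + b"
proof
  show "x \<odot> p \<in> A11" "p \<odot> x - x \<odot> p \<in> A12" "x - p \<odot> x \<in> A22"
    using triangular[OF assms] assms
    by (auto simp: A11_def A12_def A22_def mul_simps mem_simps p_idem')
  show "x = x \<odot> p + (p \<odot> x - x \<odot> p) + (x - p \<odot> x)"
    by simp
qed

lemma A12_nontrivial: obtains s where "s \<in> A12" "s \<noteq> 0"
  using faithful_left[OF corner_units(1)] p_nonzero corner_unit_simps(3) by metis

text \<open>By the resolvent assumption the invertible elements of a corner span it, so linear relations need
  only be checked for those.\<close>

lemma A11_linear_ext:
  assumes "linear f" and inv: "\<And>a a'. a \<in> A11 \<Longrightarrow> a' \<in> A11 \<Longrightarrow> a \<odot> a' = p \<Longrightarrow> a' \<odot> a = p \<Longrightarrow> f a = 0"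
    and a: "a \<in> A11"
  shows "f a = 0"
proof -
  obtain r y where y: "y \<in> A" "(r *\<^sub>R e - a) \<odot> y = e" "y \<odot> (r *\<^sub>R e - a) = e"
    using resolvent[of a] a corner_subset by blast
  \<comment> \<open>The inverse \<open>y\<close> compresses to the corner:
    \<open>y \<odot> p\<close> inverts \<open>r *\<^sub>R p - a\<close>. As \<open>p\<close> is its
    own inverse there, \<open>f\<close> vanishes on \<open>p\<close> and on
    \<open>r *\<^sub>R p - a\<close>, hence on \<open>a\<close>.\<close>
  have "r *\<^sub>R p - a \<in> A11"
    using a corner_units corner_subspace by (simp add: subspace_diff subspace_scale)
  moreover have "y \<odot> p \<in> A11"
    using triangular[OF y(1)] y(1) by (auto simp: A11_def mul_simps mem_simps)
  moreover have "(r *\<^sub>R p - a) \<odot> (y \<odot> p) = p"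
  proof -
    have "(r *\<^sub>R p - a) \<odot> (y \<odot> p) = (r *\<^sub>R e - a) \<odot> (p \<odot> (y \<odot> p))"
      using corner_unit_simps(2)[OF a] by (simp add: mul_simps flip: assoc)
    also have "\<dots> = (r *\<^sub>R e - a) \<odot> y \<odot> p"
      by (simp add: triangular y(1) assoc)
    finally show ?thesis by (simp only: y unit_left unit_right)
  qed
  moreover have "y \<odot> p \<odot> (r *\<^sub>R p - a) = p"
  proof -
    have "y \<odot> p \<odot> (r *\<^sub>R p - a) = y \<odot> (r *\<^sub>R e - a) \<odot> p"
      using corner_unit_simps(1,2)[OF a] by (simp add: mul_simps)
    then show ?thesis by (simp only: y unit_left unit_right)
  qed
  ultimately have "f (r *\<^sub>R p - a) = 0" by (rule inv)
  moreover have "f p = 0" by (rule inv[of p p]) (simp_all add: corner_units p_idem)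
  ultimately show ?thesis by (simp add: linear_diff[OF assms(1)] linear_cmul[OF assms(1)])
qed

lemma A22_linear_ext:
  assumes "linear f" and inv: "\<And>b b'. b \<in> A22 \<Longrightarrow> b' \<in> A22 \<Longrightarrow> b \<odot> b' = e - p \<Longrightarrow> b' \<odot> b = e - p \<Longrightarrow> f b = 0"
    and b: "b \<in> A22"
  shows "f b = 0"
proof -
  define q where "q = e - p"
  have q: "q \<odot> b = b" "b \<odot> q = b" "q \<odot> q = q" "q \<in> A22"
    using corner_unit_simps(5,6)[OF b] corner_units by (simp_all add: q_def mul_simps)
  have qc: "q \<odot> x \<odot> q = q \<odot> x" if "x \<in> A" for x
    using triangular[OF that] by (simp add: q_def mul_simps)
  obtain r y where y: "y \<in> A" "(r *\<^sub>R e - b) \<odot> y = e" "y \<odot> (r *\<^sub>R e - b) = e"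
    using resolvent[of b] b corner_subset by blast
  have "r *\<^sub>R q - b \<in> A22"
    using b q(4) corner_subspace by (simp add: subspace_diff subspace_scale)
  moreover have "q \<odot> y \<in> A22"
    using triangular[OF y(1)] y(1) by (auto simp: q_def A22_def mul_simps mem_simps p_idem')
  moreover have "(r *\<^sub>R q - b) \<odot> (q \<odot> y) = q"
  proof -
    have "(r *\<^sub>R q - b) \<odot> (q \<odot> y) = q \<odot> ((r *\<^sub>R e - b) \<odot> y)"
      using q by (simp add: mul_simps flip: assoc)
    then show ?thesis by (simp only: y unit_left unit_right)
  qed
  moreover have "q \<odot> y \<odot> (r *\<^sub>R q - b) = q"
  proof -
    have "q \<odot> y \<odot> (r *\<^sub>R q - b) = q \<odot> y \<odot> q \<odot> (r *\<^sub>R e - b)"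
      using q by (simp add: mul_simps)
    also have "\<dots> = q \<odot> (y \<odot> (r *\<^sub>R e - b))"
      using qc[OF y(1)] by (simp add: assoc flip: assoc)
    finally show ?thesis by (simp only: y unit_left unit_right)
  qed
  ultimately have "f (r *\<^sub>R q - b) = 0" unfolding q_def by (rule inv)
  moreover have "f q = 0" by (rule inv[of q q]) (use q in \<open>simp_all add: q_def\<close>)
  ultimately show ?thesis by (simp add: linear_diff[OF assms(1)] linear_cmul[OF assms(1)])
qed

section \<open>Defect relations from factorizations of \<open>C\<close>\<close>

text \<open>The \<open>a\<close> term yields \<open>p \<odot> C - s \<odot> b\<close>, the
  \<open>s\<close> term restores \<open>s \<odot> b\<close>, and the last term yields
  \<open>C - p \<odot> C\<close>, which right multiplication by \<open>e - p\<close> fixes. The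
  other products vanish by corner orthogonality.\<close>

lemma corner_factorization:
  assumes C: "C \<in> A" and a: "a \<in> A11" "a' \<in> A11" "a \<odot> a' = p"
    and b: "b \<in> A22" "b' \<in> A22" "b' \<odot> b = e - p" and s: "s \<in> A12"
  shows "(a + s + (C - p \<odot> C) \<odot> b') \<odot> (a' \<odot> (C - s \<odot> b) + b) = C"
proof -
  have 1: "a \<odot> (a' \<odot> x) = p \<odot> x" for x
    using a(3) by (simp flip: assoc)
  have 2: "s \<odot> (a' \<odot> x) = 0" "b' \<odot> (a' \<odot> x) = 0" for x
    using corner_zero(1)[OF s a(2)] corner_zero(3)[OF b(2) a(2)]
    by (simp_all add: mul_simps(9) flip: assoc)
  have 3: "p \<odot> (s \<odot> x) = s \<odot> x" for x
    using s by (simp add: corner_unit_simps flip: assoc)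
  have "(a + s + (C - p \<odot> C) \<odot> b') \<odot> (a' \<odot> (C - s \<odot> b) + b) = p \<odot> C + (C - p \<odot> C) \<odot> (e - p)"
    using a(3) b(3) corner_zero(5)[OF a(1) b(1)] by (simp add: mul_simps 1 2 3)
  also have "\<dots> = C"
    using triangular[OF C] by (simp add: mul_simps)
  finally show ?thesis .
qed

text \<open>The defect is bilinear and vanishes at all these factorizations. Independent rescaling
  isolates single terms for invertible \<open>a\<close> and \<open>b\<close>; linearity then reaches
  all corner elements.\<close>

lemma jordan_defect_corner_relations:
  assumes lin: "linear \<delta>" and C: "C \<in> A"
    and derivable: "\<And>x y. x \<in> A \<Longrightarrow> y \<in> A \<Longrightarrow> x \<odot> y = C \<Longrightarrow> jordan_defect (\<bullet>\<^sub>J) \<delta> x y = 0"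
    and a: "a \<in> A11" and s: "s \<in> A12" and b: "b \<in> A22"
  shows "jordan_defect (\<bullet>\<^sub>J) \<delta> a b = 0"
    and "jordan_defect (\<bullet>\<^sub>J) \<delta> (a \<odot> s) b = jordan_defect (\<bullet>\<^sub>J) \<delta> a (s \<odot> b)"
proof -
  define \<phi> where "\<phi> = jordan_defect (\<bullet>\<^sub>J) \<delta>"
  have bil: "bilinear \<phi>"
    unfolding \<phi>_def using bilinear_jprod lin by (rule bilinear_jordan_defect)
  note \<phi>_simps = bilinear_ladd[OF bil] bilinear_radd[OF bil] bilinear_lsub[OF bil] bilinear_rsub[OF bil]
    bilinear_lneg[OF bil] bilinear_rneg[OF bil] bilinear_lmul[OF bil] bilinear_rmul[OF bil]
    bilinear_lzero[OF bil] bilinear_rzero[OF bil]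
  have factor: "\<phi> (a + s + (C - p \<odot> C) \<odot> b') (a' \<odot> (C - s \<odot> b) + b) = 0"
    if "a \<in> A11" "a' \<in> A11" "a \<odot> a' = p" "b \<in> A22" "b' \<in> A22" "b' \<odot> b = e - p" "s \<in> A12"
    for a a' b b' s
    unfolding \<phi>_def using corner_factorization[OF C that] that C
    by (intro derivable) (simp_all add: mem_simps corner_subset)
  have inv: "\<phi> a b = 0" "\<phi> s b = \<phi> a (a' \<odot> (s \<odot> b))"
    if a: "a \<in> A11" "a' \<in> A11" "a \<odot> a' = p" and b: "b \<in> A22" "b' \<in> A22" "b' \<odot> b = e - p"
      and s: "s \<in> A12" for a a' b b' s
  proof -
    define D where "D = (C - p \<odot> C) \<odot> b'"
    have zero: "0 \<in> A12" using corner_subspace by (simp add: subspace_0)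
    \<comment> \<open>\<open>\<alpha>\<close>, \<open>\<beta>\<close>, \<open>\<sigma>\<close> scale
      \<open>a\<close>, \<open>b\<close>, \<open>s\<close>, while \<open>a'\<close> and
      \<open>b'\<close> scale by the reciprocals.\<close>
    have scaled: "\<phi> (\<alpha> *\<^sub>R a + \<sigma> *\<^sub>R s + (1/\<beta>) *\<^sub>R D)
        ((1/\<alpha>) *\<^sub>R (a' \<odot> C) - (1/\<alpha>) *\<^sub>R (\<sigma> *\<^sub>R (\<beta> *\<^sub>R (a' \<odot> (s \<odot> b)))) + \<beta> *\<^sub>R b) = 0"
      if "\<alpha> \<noteq> 0" "\<beta> \<noteq> 0" for \<alpha> \<beta> \<sigma> :: real
      using factor[of "\<alpha> *\<^sub>R a" "(1/\<alpha>) *\<^sub>R a'" "\<beta> *\<^sub>R b" "(1/\<beta>) *\<^sub>R b'" "\<sigma> *\<^sub>R s"] that a b s corner_subspace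
      by (simp add: mul_simps subspace_scale D_def scaleR_diff_right mult.commute)
    \<comment> \<open>At \<open>\<sigma> = 0\<close> and \<open>\<beta> = 1\<close> the expansion is
      \<open>?u\<close> + \<alpha> \<open>?v\<close> + \<alpha>^(-1) \<open>?w\<close>.\<close>
    let ?u = "\<phi> a (a' \<odot> C) + \<phi> D b" and ?v = "\<phi> a b" and ?w = "\<phi> D (a' \<odot> C)"
    have 0: "?u = 0" "?v = 0" "?w = 0"
    proof -
      have "?u + ?v + ?w = 0"
        using scaled[of 1 1 0] by (simp add: \<phi>_simps algebra_simps)
      moreover have "?u - ?v - ?w = 0"
        using scaled[of "-1" 1 0] by (simp add: \<phi>_simps algebra_simps)
      moreover have "?u + 2 *\<^sub>R ?v + (1/2) *\<^sub>R ?w = 0"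
        using scaled[of 2 1 0] by (simp add: \<phi>_simps algebra_simps)
      ultimately show "?u = 0" "?v = 0" "?w = 0" by (rule odd_laurent_coeff_zero)+
    qed
    show "\<phi> a b = 0" by (fact 0)
    \<comment> \<open>Given these zeros, the expansion at \<open>\<alpha> = 1\<close> reduces to
      \<sigma> \<beta> \<open>?x\<close> + \<sigma> \<open>?y\<close> - \<sigma>^2 \<beta>
      \<open>?z\<close>; three choices of signs isolate \<open>?x\<close>.\<close>
    let ?x = "\<phi> s b - \<phi> a (a' \<odot> (s \<odot> b))"
    let ?y = "\<phi> s (a' \<odot> C) - \<phi> D (a' \<odot> (s \<odot> b))" and ?z = "\<phi> s (a' \<odot> (s \<odot> b))"
    have Db: "\<phi> D b = - \<phi> a (a' \<odot> C)"
      using 0(1) by (simp add: eq_neg_iff_add_eq_0 add.commute)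
    have 1: "?x + ?y - ?z = 0"
      using scaled[of 1 1 1] by (simp add: \<phi>_simps Db 0(2,3) algebra_simps)
    have 2: "?x + ?y + ?z = 0"
      using scaled[of 1 1 "-1"] by (simp add: \<phi>_simps Db 0(2,3) algebra_simps)
    have 3: "?x - ?y - ?z = 0"
      using scaled[of 1 "-1" 1] by (simp add: \<phi>_simps Db 0(2,3) algebra_simps)
    have "?x + ?x = (?x + ?y + ?z) + (?x - ?y - ?z)" by simp
    then have "?x + ?x = 0" unfolding 2 3 by simp
    then show "\<phi> s b = \<phi> a (a' \<odot> (s \<odot> b))" by (simp only: double_eq_0 right_minus_eq)
  qed
  have lin\<phi>: "linear (\<lambda>x. \<phi> x y)" "linear (\<lambda>y. \<phi> x y)" for x y
    using bil by (simp_all add: bilinear_def)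
  have "\<phi> a b = 0"
  proof (rule A22_linear_ext[OF lin\<phi>(2) _ b])
    fix b b' assume b: "b \<in> A22" "b' \<in> A22" "b' \<odot> b = e - p"
    show "\<phi> a b = 0"
      by (rule A11_linear_ext[OF lin\<phi>(1) _ a]) (rule inv(1)[OF _ _ _ b s])
  qed
  then show "jordan_defect (\<bullet>\<^sub>J) \<delta> a b = 0" by (simp add: \<phi>_def)
  \<comment> \<open>Substituting \<open>a \<odot> s\<close> for \<open>s\<close> in
    \<open>inv(2)\<close> cancels \<open>a'\<close>. The relation becomes linear in \<open>a\<close>
    and in \<open>b\<close>, so it extends beyond invertible elements.\<close>
  have "\<phi> (a \<odot> s) b - \<phi> a (s \<odot> b) = 0"
  proof (rule A22_linear_ext[OF _ _ b])
    show "linear (\<lambda>b. \<phi> (a \<odot> s) b - \<phi> a (s \<odot> b))"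
      by (simp add: linear_iff \<phi>_simps mul_simps algebra_simps)
    fix b b' assume b: "b \<in> A22" "b' \<in> A22" "b' \<odot> b = e - p"
    show "\<phi> (a \<odot> s) b - \<phi> a (s \<odot> b) = 0"
    proof (rule A11_linear_ext[OF _ _ a])
      show "linear (\<lambda>a. \<phi> (a \<odot> s) b - \<phi> a (s \<odot> b))"
        by (simp add: linear_iff \<phi>_simps mul_simps algebra_simps)
      fix a a' assume a: "a \<in> A11" "a' \<in> A11" "a \<odot> a' = p" "a' \<odot> a = p"
      have "a' \<odot> (a \<odot> s \<odot> b) = s \<odot> b"
        using a(4) s by (simp add: corner_unit_simps flip: assoc)
      then show "\<phi> (a \<odot> s) b - \<phi> a (s \<odot> b) = 0"
        using inv(2)[OF a(1-3) b corner_closed(2)[OF a(1) s]] by simp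
    qed
  qed
  then show "jordan_defect (\<bullet>\<^sub>J) \<delta> (a \<odot> s) b = jordan_defect (\<bullet>\<^sub>J) \<delta> a (s \<odot> b)"
    by (simp add: \<phi>_def)
qed

section \<open>From the corner relations to derivations\<close>

text \<open>\<open>normalized\<close> means p \<delta>(p) q = 0 and makes \<open>\<delta>\<close>
  preserve each corner. Once \<delta>(p) = \<delta>(q) = 0 is known, the second defect relation is
  the product rule on \<open>A12\<close>, and faithfulness carries it to the diagonal
  corners.\<close>

lemma derivation_of_jordan_derivable_normalized:
  assumes lin: "linear \<delta>" and maps: "\<And>x. x \<in> A \<Longrightarrow> \<delta> x \<in> A" and C: "C \<in> A"
    and derivable: "\<And>x y. x \<in> A \<Longrightarrow> y \<in> A \<Longrightarrow> x \<odot> y = C \<Longrightarrow> jordan_defect (\<bullet>\<^sub>J) \<delta> x y = 0"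
    and normalized: "p \<odot> (\<delta> p \<odot> p) = p \<odot> \<delta> p"
    and xy: "x \<in> A" "y \<in> A"
  shows "\<delta> (x \<odot> y) = \<delta> x \<odot> y + x \<odot> \<delta> y"
proof -
  define q where "q = e - p"
  define k where "k = \<delta> p"
  define l where "l = \<delta> q"
  note [simp] = linear_0[OF lin] linear_add[OF lin] linear_diff[OF lin]
    corner_zero corner_closed corner_unit_simps
  note relations = jordan_defect_corner_relations[OF lin C derivable]
  have q: "q \<in> A22" "q \<in> A" using corner_units by (auto simp: q_def corner_subset)
  have q_simps: "b \<odot> q = b" "q \<odot> b = b" "s \<odot> q = s" "q \<odot> s = 0"
    if "b \<in> A22" "s \<in> A12" for b s
    using that by (simp_all add: q_def mul_simps)
  have p\<delta>p: "p \<odot> (\<delta> x \<odot> p) = \<delta> x \<odot> p" if "x \<in> A" for x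
    using triangular[OF maps[OF that]] .
  obtain s\<^sub>1 where s\<^sub>1: "s\<^sub>1 \<in> A12" "s\<^sub>1 \<noteq> 0" by (rule A12_nontrivial)

  have orth: "\<delta> a \<odot> b + b \<odot> \<delta> a + a \<odot> \<delta> b + \<delta> b \<odot> a = 0" if "a \<in> A11" "b \<in> A22" for a b
  proof -
    have "jordan_defect (\<bullet>\<^sub>J) \<delta> a b = 0"
      using relations(1)[OF _ _ _ that(1) s\<^sub>1(1) that(2)] .
    then have "- (\<delta> a \<odot> b + b \<odot> \<delta> a + a \<odot> \<delta> b + \<delta> b \<odot> a) = 0"
      using that by (simp add: jordan_defect_def jprod_def algebra_simps)
    then show ?thesis by (simp only: neg_equal_0_iff_equal)
  qed
  \<comment> \<open>Multiplying \<open>orth\<close> for \<open>b = q\<close> by \<open>q\<close> on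
    both sides leaves 2 q \<delta>(a) q = 0, and q \<delta>(a) p = 0 holds by triangularity.\<close>
  have p\<delta>A11: "p \<odot> \<delta> a = \<delta> a" if a: "a \<in> A11" for a
  proof -
    have "q \<odot> (\<delta> a \<odot> q + q \<odot> \<delta> a + a \<odot> \<delta> q + \<delta> q \<odot> a) \<odot> q = 0"
      using orth[OF a q(1)] by (simp add: mul_simps)
    moreover have "q \<odot> (a \<odot> x) = 0" "a \<odot> q = 0" for x
      using a q(1) by (simp_all flip: assoc add: mul_simps(9))
    moreover have "q \<odot> \<delta> a \<odot> q = q \<odot> \<delta> a"
      using p\<delta>p[of a] a by (simp add: q_def mul_simps corner_subset)
    ultimately have "q \<odot> \<delta> a + q \<odot> \<delta> a = 0"
      using q_simps(1)[OF q(1) s\<^sub>1(1)] by (simp add: mul_simps) (simp flip: assoc)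
    then show ?thesis by (simp add: double_eq_0 q_def mul_simps)
  qed
  have \<delta>A22p: "\<delta> b \<odot> p = 0" if b: "b \<in> A22" for b
  proof -
    have "p \<odot> (\<delta> p \<odot> b + b \<odot> \<delta> p + p \<odot> \<delta> b + \<delta> b \<odot> p) \<odot> p = 0"
      using orth[OF corner_units(1) b] by (simp add: mul_simps)
    moreover have "p \<odot> (b \<odot> x) = 0" for x
      using b by (simp flip: assoc add: mul_simps(9))
    ultimately have "\<delta> b \<odot> p + \<delta> b \<odot> p = 0"
      using p\<delta>p[of b] b by (simp add: mul_simps corner_subset p_idem')
    then show ?thesis by (simp add: double_eq_0)
  qed
  have orth': "\<delta> a \<odot> b + a \<odot> \<delta> b = 0" if "a \<in> A11" "b \<in> A22" for a b
    using orth[OF that] mul_zero1[of b "\<delta> a"] mul_zero1[of "\<delta> b" a] that p\<delta>A11 \<delta>A22p by simp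
  \<comment> \<open>The normalization enters here: it gives \<open>k \<odot> b = 0\<close> and
    thereby removes the \<open>A12\<close> component of \<open>\<delta> b\<close>.\<close>
  have k: "k \<odot> p = k" using normalized p\<delta>A11[OF corner_units(1)]
    by (metis k_def assoc)
  have p\<delta>A22: "p \<odot> \<delta> b = 0" if b: "b \<in> A22" for b
    using orth'[OF corner_units(1) b] mul_zero2[OF k, of b] b by (simp add: k_def)
  have \<delta>A22: "\<delta> b \<in> A22" if "b \<in> A22" for b
    by (rule cornerI(3)[OF maps[OF corner_subset(3)[OF that]] p\<delta>A22[OF that] \<delta>A22p[OF that]])
  have \<delta>A11: "\<delta> a \<in> A11" if a: "a \<in> A11" for a
  proof -
    have "\<delta> a \<odot> q = 0"
      using orth'[OF a q(1)] a \<delta>A22[OF q(1)] by simp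
    then have "\<delta> a \<odot> p = \<delta> a" by (simp add: q_def mul_simps)
    then show ?thesis by (rule cornerI(1)[OF maps[OF corner_subset(1)[OF a]] p\<delta>A11[OF a]])
  qed
  have kl: "k \<in> A11" "l \<in> A22"
    using \<delta>A11[OF corner_units(1)] \<delta>A22[OF q(1)] by (simp_all add: k_def l_def)

  have \<delta>A12_kl: "\<delta> s \<in> A12 \<and> k \<odot> s = s \<odot> l" if s: "s \<in> A12" for s
  proof -
    \<comment> \<open>The second relation at \<open>a = p\<close>, \<open>b = q\<close> gives
      \<open>eq\<close>. Multiplication by \<open>p\<close> on both sides shows \<delta>(s) p = 0,
      multiplication by \<open>q\<close> on the left shows q \<delta>(s) = 0, and
      \<open>k \<odot> s = s \<odot> l\<close> is what is left.\<close>
    have "jordan_defect (\<bullet>\<^sub>J) \<delta> (p \<odot> s) q = jordan_defect (\<bullet>\<^sub>J) \<delta> p (s \<odot> q)"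
      using relations(2)[OF _ _ _ corner_units(1) s q(1)] .
    then have "\<delta> s - \<delta> s \<odot> q - q \<odot> \<delta> s - s \<odot> l = \<delta> s - k \<odot> s - p \<odot> \<delta> s - \<delta> s \<odot> p"
      using s kl q by (simp add: q_simps jordan_defect_def jprod_def algebra_simps flip: k_def l_def)
    then have eq: "\<delta> s + \<delta> s + s \<odot> l = k \<odot> s + p \<odot> \<delta> s + p \<odot> \<delta> s + \<delta> s \<odot> p + \<delta> s \<odot> p"
      by (simp add: q_def mul_simps algebra_simps)
    from arg_cong[OF this, of "\<lambda>x. p \<odot> x \<odot> p"] have "\<delta> s \<odot> p + \<delta> s \<odot> p = 0"
      using p\<delta>p[of s] s kl by (simp add: mul_simps corner_subset p_idem')
    then have r: "\<delta> s \<odot> p = 0" by (simp add: double_eq_0)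
    from arg_cong[OF eq, of "\<lambda>x. x - p \<odot> x"] have "(\<delta> s - p \<odot> \<delta> s) + (\<delta> s - p \<odot> \<delta> s) = 0"
      using s kl by (simp add: r mul_simps p_idem' algebra_simps flip: assoc)
    then have l: "p \<odot> \<delta> s = \<delta> s" by (simp only: double_eq_0 right_minus_eq)
    have "\<delta> s + \<delta> s + s \<odot> l = \<delta> s + \<delta> s + k \<odot> s"
      unfolding eq by (simp add: l r ac_simps)
    then have "k \<odot> s = s \<odot> l" by (simp only: add_left_cancel)
    with cornerI(2)[OF maps[OF corner_subset(2)[OF s]] l r] show ?thesis by (rule conjI)
  qed
  then have \<delta>A12: "\<delta> s \<in> A12" and kl_comm: "k \<odot> s = s \<odot> l" if "s \<in> A12" for s
    using that by auto

  \<comment> \<open>Both Jordan products in the second relation reduce to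
    \<open>a \<odot> s \<odot> b\<close>, whose image under \<open>\<delta>\<close> cancels.\<close>
  have mixed: "\<delta> (a \<odot> s) \<odot> b + a \<odot> s \<odot> \<delta> b = \<delta> a \<odot> s \<odot> b + a \<odot> \<delta> (s \<odot> b)"
    if a: "a \<in> A11" and s: "s \<in> A12" and b: "b \<in> A22" for a s b
  proof -
    have "jordan_defect (\<bullet>\<^sub>J) \<delta> (a \<odot> s) b = jordan_defect (\<bullet>\<^sub>J) \<delta> a (s \<odot> b)"
      using relations(2)[OF _ _ _ a s b] .
    then have "\<delta> (a \<odot> s \<odot> b) - (\<delta> (a \<odot> s) \<odot> b + a \<odot> s \<odot> \<delta> b) =
        \<delta> (a \<odot> s \<odot> b) - (\<delta> a \<odot> (s \<odot> b) + a \<odot> \<delta> (s \<odot> b))"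
      using a s b \<delta>A11[OF a] \<delta>A12[OF corner_closed(2)[OF a s]] \<delta>A22[OF b] \<delta>A12[OF corner_closed(3)[OF s b]]
      by (simp add: jordan_defect_def jprod_def mul_simps(9-11) diff_diff_eq)
    from diff_left_imp_eq[OF this] show ?thesis by (simp add: assoc)
  qed

  \<comment> \<open>As \<open>k \<odot> s = s \<odot> l\<close> on \<open>A12\<close>,
    \<open>torsion_free\<close> reduces the claim to one nonzero \<open>t\<close> in
    \<open>A12\<close> with \<open>k \<odot> t = 0\<close>. The factorization
    \<open>e \<odot> C = C\<close> makes \<open>k + l\<close> anticommute with \<open>C\<close>, and
    the corner components of this provide \<open>t\<close> when \<open>C\<close> is nonzero.\<close>
  have "k = 0"
  proof -
    have "\<delta> e = k + l" by (simp add: k_def l_def q_def)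
    then have "(k + l) \<odot> C + C \<odot> (k + l) = - jordan_defect (\<bullet>\<^sub>J) \<delta> e C"
      by (simp add: jordan_defect_def jprod_def unit_left unit_right algebra_simps)
    also have "\<dots> = 0"
      using derivable[of e C] by (simp add: unit_mem C unit_left)
    finally have "(k + l) \<odot> C + C \<odot> (k + l) = 0" .
    moreover obtain c\<^sub>1 s\<^sub>0 c\<^sub>2 where c: "c\<^sub>1 \<in> A11" "s\<^sub>0 \<in> A12" "c\<^sub>2 \<in> A22" "C = c\<^sub>1 + s\<^sub>0 + c\<^sub>2"
      using corner_decompose[OF C] .
    ultimately have sum: "k \<odot> c\<^sub>1 + c\<^sub>1 \<odot> k + (k \<odot> s\<^sub>0 + k \<odot> s\<^sub>0) + (l \<odot> c\<^sub>2 + c\<^sub>2 \<odot> l) = 0"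
      using kl by (simp add: mul_simps kl_comm algebra_simps)
    from arg_cong[OF this, of "\<lambda>x. x \<odot> p"] have 1: "k \<odot> c\<^sub>1 + c\<^sub>1 \<odot> k = 0"
      using kl c by (simp add: mul_simps)
    from arg_cong[OF sum, of "\<lambda>x. p \<odot> x"] 1 have 0: "k \<odot> s\<^sub>0 + k \<odot> s\<^sub>0 = 0"
      using kl c by (simp add: mul_simps)
    from sum 0 1 have 2: "l \<odot> c\<^sub>2 + c\<^sub>2 \<odot> l = 0" by simp
    have "\<exists>t\<in>A12. t \<noteq> 0 \<and> k \<odot> t = 0"
    proof (cases "C = 0")
      case True
      \<comment> \<open>For \<open>C = 0\<close> the anticommutation is empty; the factorization
        \<open>q \<odot> s\<^sub>1 = 0\<close> replaces it.\<close>
      have "jordan_defect (\<bullet>\<^sub>J) \<delta> q s\<^sub>1 = 0"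
        by (rule derivable) (simp_all add: q s\<^sub>1 corner_subset True)
      then have "k \<odot> s\<^sub>1 = 0"
        using s\<^sub>1 q kl \<delta>A12[OF s\<^sub>1(1)]
        by (simp add: jordan_defect_def jprod_def q_simps kl_comm flip: l_def)
      with s\<^sub>1 show ?thesis by auto
    next
      case False
      then consider "s\<^sub>0 \<noteq> 0" | "c\<^sub>1 \<noteq> 0" | "c\<^sub>2 \<noteq> 0"
        using c(4) by (metis add_0_right)
      then show ?thesis
      proof cases
        case 1
        with 0 c show ?thesis by (auto simp: double_eq_0)
      next
        \<comment> \<open>Here \<open>t\<close> is \<open>c\<^sub>1 \<odot> s\<close>. Moving
          \<open>k\<close> through by \<open>kl_comm\<close> turns 2 k t into the anticommutator of
          \<open>k\<close> and \<open>c\<^sub>1\<close>, applied to \<open>s\<close>. The remaining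
          case is the mirror image.\<close>
        case 2
        then obtain s where s: "s \<in> A12" "c\<^sub>1 \<odot> s \<noteq> 0" using faithful_left c by blast
        have "k \<odot> (c\<^sub>1 \<odot> s) + k \<odot> (c\<^sub>1 \<odot> s) = (k \<odot> c\<^sub>1 + c\<^sub>1 \<odot> k) \<odot> s"
          using kl_comm[OF corner_closed(2)[OF c(1) s(1)]] kl_comm[OF s(1)] by (simp add: mul_simps)
        with 1 s c show ?thesis by (intro bexI[of _ "c\<^sub>1 \<odot> s"]) (auto simp: double_eq_0 mul_simps)
      next
        case 3
        then obtain s where s: "s \<in> A12" "s \<odot> c\<^sub>2 \<noteq> 0" using faithful_right c by blast
        have "k \<odot> (s \<odot> c\<^sub>2) + k \<odot> (s \<odot> c\<^sub>2) = k \<odot> s \<odot> c\<^sub>2 + s \<odot> c\<^sub>2 \<odot> l"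
          using kl_comm[OF corner_closed(3)[OF s(1) c(3)]] by (simp add: assoc)
        also have "\<dots> = s \<odot> (l \<odot> c\<^sub>2 + c\<^sub>2 \<odot> l)"
          by (simp add: kl_comm s mul_simps)
        finally show ?thesis using 2 s c
          by (intro bexI[of _ "s \<odot> c\<^sub>2"]) (auto simp: double_eq_0 mul_simps)
      qed
    qed
    then show ?thesis using torsion_free[OF kl kl_comm] by blast
  qed
  moreover have "l = 0"
    using faithful_right[OF kl(2)] kl_comm \<open>k = 0\<close> by (metis bilinear_lzero[OF bilinear])
  \<comment> \<open>\<open>mixed\<close> is taken at \<open>b = q\<close> and at
    \<open>a = p\<close>, where now \<open>\<delta> q = 0\<close> and
    \<open>\<delta> p = 0\<close>.\<close>
  ultimately have deriv12: "\<delta> (a \<odot> s) = \<delta> a \<odot> s + a \<odot> \<delta> s" "\<delta> (s \<odot> b) = \<delta> s \<odot> b + s \<odot> \<delta> b"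
    if "a \<in> A11" "s \<in> A12" "b \<in> A22" for a s b
    using mixed[OF that(1,2) q(1)] mixed[OF corner_units(1) that(2,3)] that
      \<delta>A12[OF that(2)] \<delta>A12[OF corner_closed(2)[OF that(1,2)]] \<delta>A12[OF corner_closed(3)[OF that(2,3)]]
      \<delta>A11[OF that(1)] q(1)
    by (simp_all add: q_simps mul_simps flip: k_def l_def)
  \<comment> \<open>Computing \<delta>(a a' s) by \<open>deriv12\<close> in two ways shows that the
    deviation from the product rule annihilates \<open>A12\<close>.\<close>
  have deriv11: "\<delta> (a \<odot> a') = \<delta> a \<odot> a' + a \<odot> \<delta> a'" if a: "a \<in> A11" "a' \<in> A11" for a a'
  proof -
    have "\<delta> (a \<odot> a') - (\<delta> a \<odot> a' + a \<odot> \<delta> a') = 0"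
    proof (rule faithful_left)
      show "\<delta> (a \<odot> a') - (\<delta> a \<odot> a' + a \<odot> \<delta> a') \<in> A11"
        using a \<delta>A11 corner_subspace by (simp add: subspace_diff subspace_add)
      fix s assume s: "s \<in> A12"
      have "\<delta> (a \<odot> a') \<odot> s = \<delta> (a \<odot> a' \<odot> s) - a \<odot> a' \<odot> \<delta> s"
        using deriv12(1)[OF corner_closed(1)[OF a] s q(1)] by simp
      also have "\<dots> = \<delta> a \<odot> (a' \<odot> s) + a \<odot> (\<delta> a' \<odot> s)"
        using deriv12(1)[OF a(1) corner_closed(2)[OF a(2) s] q(1)] deriv12(1)[OF a(2) s q(1)]
        by (simp add: mul_simps)
      finally show "(\<delta> (a \<odot> a') - (\<delta> a \<odot> a' + a \<odot> \<delta> a')) \<odot> s = 0"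
        by (simp add: mul_simps)
    qed
    then show ?thesis by simp
  qed
  have deriv22: "\<delta> (b \<odot> b') = \<delta> b \<odot> b' + b \<odot> \<delta> b'" if b: "b \<in> A22" "b' \<in> A22" for b b'
  proof -
    have "\<delta> (b \<odot> b') - (\<delta> b \<odot> b' + b \<odot> \<delta> b') = 0"
    proof (rule faithful_right)
      show "\<delta> (b \<odot> b') - (\<delta> b \<odot> b' + b \<odot> \<delta> b') \<in> A22"
        using b \<delta>A22 corner_subspace by (simp add: subspace_diff subspace_add)
      fix s assume s: "s \<in> A12"
      have "s \<odot> \<delta> (b \<odot> b') = \<delta> (s \<odot> b \<odot> b') - \<delta> s \<odot> (b \<odot> b')"
        using deriv12(2)[OF corner_units(1) s corner_closed(4)[OF b]] by (simp add: assoc)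
      also have "\<dots> = s \<odot> (\<delta> b \<odot> b') + s \<odot> (b \<odot> \<delta> b')"
        using deriv12(2)[OF corner_units(1) corner_closed(3)[OF s b(1)] b(2)]
          deriv12(2)[OF corner_units(1) s b(1)]
        by (simp add: mul_simps)
      finally show "s \<odot> (\<delta> (b \<odot> b') - (\<delta> b \<odot> b' + b \<odot> \<delta> b')) = 0"
        by (simp add: mul_simps)
    qed
    then show ?thesis by simp
  qed
  obtain a s b where x: "a \<in> A11" "s \<in> A12" "b \<in> A22" "x = a + s + b"
    using corner_decompose[OF xy(1)] .
  obtain a' s' b' where y: "a' \<in> A11" "s' \<in> A12" "b' \<in> A22" "y = a' + s' + b'"
    using corner_decompose[OF xy(2)] .
  show ?thesis
    using x(1-3) y(1-3) \<delta>A11 \<delta>A12 \<delta>A22 deriv11[OF x(1) y(1)] deriv22[OF x(3) y(3)]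
      deriv12(1)[OF x(1) y(2) q(1)] deriv12(2)[OF corner_units(1) x(2) y(3)]
    unfolding x(4) y(4) by (simp add: mul_simps)
qed

text \<open>Inner derivations have zero defect, so subtracting one keeps derivability at
  \<open>C\<close>. For n = p \<delta>(p) q one has p n - n p = n, which is the part of \<delta>(p)
  that normalization forbids.\<close>

lemma derivation_of_jordan_derivable:
  assumes lin: "linear \<delta>" and maps: "\<And>x. x \<in> A \<Longrightarrow> \<delta> x \<in> A" and C: "C \<in> A"
    and derivable: "\<And>x y. x \<in> A \<Longrightarrow> y \<in> A \<Longrightarrow> x \<odot> y = C \<Longrightarrow> jordan_defect (\<bullet>\<^sub>J) \<delta> x y = 0"
    and xy: "x \<in> A" "y \<in> A"
  shows "\<delta> (x \<odot> y) = \<delta> x \<odot> y + x \<odot> \<delta> y"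
proof -
  define n where "n = p \<odot> \<delta> p \<odot> (e - p)"
  define \<delta>' where "\<delta>' x = \<delta> x - (x \<odot> n - n \<odot> x)" for x
  have n: "n \<in> A" by (simp add: n_def mem_simps maps)
  have "\<delta>' (x \<odot> y) = \<delta>' x \<odot> y + x \<odot> \<delta>' y"
  proof (rule derivation_of_jordan_derivable_normalized[OF _ _ C])
    show "linear \<delta>'"
      by (simp add: linear_iff \<delta>'_def mul_simps linear_add[OF lin] linear_cmul[OF lin] algebra_simps)
    show "\<delta>' x \<in> A" if "x \<in> A" for x
      using that n by (simp add: \<delta>'_def mem_simps maps)
    show "jordan_defect (\<bullet>\<^sub>J) \<delta>' x y = 0" if "x \<in> A" "y \<in> A" "x \<odot> y = C" for x y
      using derivable[OF that]
      by (simp add: jordan_defect_def jprod_def \<delta>'_def mul_simps linear_add[OF lin] algebra_simps)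
    show "p \<odot> (\<delta>' p \<odot> p) = p \<odot> \<delta>' p"
      by (simp add: \<delta>'_def n_def mul_simps p_idem')
  qed (use xy in auto)
  then show ?thesis by (simp add: \<delta>'_def mul_simps algebra_simps)
qed

lemma jordan_derivation_of_jordan_derivable:
  assumes "linear \<delta>" "\<And>x. x \<in> A \<Longrightarrow> \<delta> x \<in> A" "C \<in> A"
    and "\<And>x y. x \<in> A \<Longrightarrow> y \<in> A \<Longrightarrow> x \<odot> y = C \<Longrightarrow> jordan_defect (\<bullet>\<^sub>J) \<delta> x y = 0"
    and "x \<in> A" "y \<in> A"
  shows "jordan_defect (\<bullet>\<^sub>J) \<delta> x y = 0"
proof -
  have "\<delta> (x \<odot> y) = \<delta> x \<odot> y + x \<odot> \<delta> y" "\<delta> (y \<odot> x) = \<delta> y \<odot> x + y \<odot> \<delta> x"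
    by (rule derivation_of_jordan_derivable[OF assms(1-4)]; use assms in simp)+
  then show ?thesis
    by (simp add: jordan_defect_def jprod_def linear_add[OF assms(1)] algebra_simps)
qed

end

section \<open>Higher sequences and their logarithmic derivative\<close>

lemma triangle_eq_Sigma:
  fixes n :: nat
  shows "{(i, j). i + j \<le> n} = Sigma {..n} (\<lambda>i. {..n - i})"
  by auto

lemma sum_triangle_diagonal:
  fixes g :: "nat \<Rightarrow> nat \<Rightarrow> 'b::comm_monoid_add"
  shows "(\<Sum>k\<le>n. \<Sum>i\<le>n - k. g k i) = (\<Sum>m\<le>n. \<Sum>k\<le>m. g k (m - k))"
  unfolding sum.triangle_reindex_eq[symmetric] triangle_eq_Sigma by (simp add: sum.Sigma)

lemma sum_triangle_swap:
  fixes g :: "nat \<Rightarrow> nat \<Rightarrow> 'b::comm_monoid_add"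
  shows "(\<Sum>k\<le>n. \<Sum>i\<le>n - k. g k i) = (\<Sum>i\<le>n. \<Sum>k\<le>n - i. g k i)"
  by (simp add: sum.Sigma, rule sum.reindex_bij_witness[where i = prod.swap and j = prod.swap]) auto

text \<open>The coefficients of the formal logarithmic derivative: with \<open>D(t) = \<Sum> d\<^sub>n t\<^sup>n\<close> and
  \<open>\<Delta>(t) = \<Sum> \<delta>\<^sub>n t\<^sup>n\<close> they satisfy \<open>t D'(t) = \<Delta>(t) D(t)\<close>.\<close>

function log_deriv :: "(nat \<Rightarrow> 'r::real_vector \<Rightarrow> 'r) \<Rightarrow> nat \<Rightarrow> 'r \<Rightarrow> 'r" where
  "log_deriv d n x = real n *\<^sub>R d n x - (\<Sum>k\<in>{..<n}. log_deriv d k (d (n - k) x))"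
  by auto
termination by (relation "Wellfounded.measure (\<lambda>(d, n, x). n)") auto

declare log_deriv.simps [simp del]

lemma linear_log_deriv:
  fixes d :: "nat \<Rightarrow> 'r::real_vector \<Rightarrow> 'r"
  assumes "\<And>n. linear (d n)"
  shows "linear (log_deriv d n)"
proof (induction n rule: less_induct)
  case (less n)
  have "linear (\<lambda>x. log_deriv d k (d (n - k) x))" if "k < n" for k
    using linear_compose[OF assms less[OF that]] by (simp add: o_def)
  then show ?case
    by (subst log_deriv.simps[abs_def])
      (intro linear_compose_sub linear_compose_sum ballI module_hom_scale linear_compose_scale_right assms; simp)
qed

lemma log_deriv_closed:
  fixes d :: "nat \<Rightarrow> 'r::real_vector \<Rightarrow> 'r"
  assumes "subspace A" "\<And>n x. x \<in> A \<Longrightarrow> d n x \<in> A"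
  shows "x \<in> A \<Longrightarrow> log_deriv d n x \<in> A"
proof (induction n arbitrary: x rule: less_induct)
  case (less n)
  then show ?case
    by (subst log_deriv.simps)
      (auto intro!: subspace_diff subspace_scale subspace_sum assms)
qed

text \<open>The coefficient of t^n in t D'(t) = \<Delta>(t) D(t); the hypothesis turns the term k =
  n into \<open>log_deriv d n x\<close>.\<close>

lemma sum_log_deriv:
  assumes "d 0 x = x"
  shows "(\<Sum>k\<le>n. log_deriv d k (d (n - k) x)) = real n *\<^sub>R d n x"
  using log_deriv.simps[of d n x] by (simp add: assms flip: lessThan_Suc_atMost)

text \<open>The product rule for t d/dt on J(D(t) x, D(t) y), read at t^n. Regrouping the two sums
  produces the weights m and n - m, which add up to n.\<close>

lemma sum_log_deriv_leibniz:
  fixes d :: "nat \<Rightarrow> 'r::real_vector \<Rightarrow> 'r"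
  assumes J: "bilinear J" and d0: "d 0 x = x" "d 0 y = y"
  shows "(\<Sum>k\<le>n. \<Sum>i\<le>n - k. J (log_deriv d k (d i x)) (d (n - k - i) y) +
            J (d i x) (log_deriv d k (d (n - k - i) y))) =
         real n *\<^sub>R (\<Sum>i\<le>n. J (d i x) (d (n - i) y))"
proof -
  interpret l: linear "\<lambda>u. J u v" for v using J by (simp add: bilinear_def)
  interpret r: linear "\<lambda>v. J u v" for u using J by (simp add: bilinear_def)
  note expand = sum_log_deriv[of d x, OF d0(1)] sum_log_deriv[of d y, OF d0(2)]
  have "(\<Sum>k\<le>n. \<Sum>i\<le>n - k. J (log_deriv d k (d i x)) (d (n - k - i) y)) =
      (\<Sum>m\<le>n. \<Sum>k\<le>m. J (log_deriv d k (d (m - k) x)) (d (n - m) y))"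
    by (simp add: sum_triangle_diagonal)
  also have "\<dots> = (\<Sum>m\<le>n. real m *\<^sub>R J (d m x) (d (n - m) y))"
    by (simp only: expand l.scale l.sum[symmetric])
  finally have 1: "(\<Sum>k\<le>n. \<Sum>i\<le>n - k. J (log_deriv d k (d i x)) (d (n - k - i) y)) =
      (\<Sum>m\<le>n. real m *\<^sub>R J (d m x) (d (n - m) y))" .
  have "(\<Sum>k\<le>n. \<Sum>i\<le>n - k. J (d i x) (log_deriv d k (d (n - k - i) y))) =
      (\<Sum>i\<le>n. \<Sum>k\<le>n - i. J (d i x) (log_deriv d k (d (n - i - k) y)))"
    by (subst sum_triangle_swap) (simp add: diff_right_commute add.commute)
  also have "\<dots> = (\<Sum>i\<le>n. real (n - i) *\<^sub>R J (d i x) (d (n - i) y))"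
    by (simp only: expand r.scale r.sum[symmetric])
  finally have 2: "(\<Sum>k\<le>n. \<Sum>i\<le>n - k. J (d i x) (log_deriv d k (d (n - k - i) y))) =
      (\<Sum>i\<le>n. real (n - i) *\<^sub>R J (d i x) (d (n - i) y))" .
  show ?thesis
    unfolding sum.distrib 1 2
    by (simp add: scaleR_sum_right of_nat_diff flip: sum.distrib scaleR_left_distrib)
qed

text \<open>\<open>P\<close> marks the pairs at which the identity is given. The coefficients of the
  logarithmic derivative are shown to have zero defect, \<open>first_order\<close> leading from the
  pairs in \<open>P\<close> to all pairs; then \<open>d\<close> is rebuilt from them by
  induction.\<close>

lemma higher_derivable_everywhere:
  fixes d :: "nat \<Rightarrow> 'r::real_vector \<Rightarrow> 'r"
  assumes J: "bilinear J" and A: "subspace A" "\<And>x y. x \<in> A \<Longrightarrow> y \<in> A \<Longrightarrow> J x y \<in> A"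
    and d: "\<And>n. linear (d n)" "\<And>n x. x \<in> A \<Longrightarrow> d n x \<in> A" "\<And>x. x \<in> A \<Longrightarrow> d 0 x = x"
    and first_order: "\<And>\<delta>. linear \<delta> \<Longrightarrow> (\<And>x. x \<in> A \<Longrightarrow> \<delta> x \<in> A) \<Longrightarrow>
      (\<And>x y. x \<in> A \<Longrightarrow> y \<in> A \<Longrightarrow> P x y \<Longrightarrow> jordan_defect J \<delta> x y = 0) \<Longrightarrow>
      (\<And>x y. x \<in> A \<Longrightarrow> y \<in> A \<Longrightarrow> jordan_defect J \<delta> x y = 0)"
    and derivable: "\<And>n x y. x \<in> A \<Longrightarrow> y \<in> A \<Longrightarrow> P x y \<Longrightarrow>
      d n (J x y) = (\<Sum>i\<le>n. J (d i x) (d (n - i) y))"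
    and xy: "x \<in> A" "y \<in> A"
  shows "d n (J x y) = (\<Sum>i\<le>n. J (d i x) (d (n - i) y))"
proof -
  define \<delta> where "\<delta> = log_deriv d"
  have lin: "linear (\<delta> n)" for n
    unfolding \<delta>_def by (rule linear_log_deriv[OF d(1)])
  have closed: "\<delta> n x \<in> A" if "x \<in> A" for n x
    unfolding \<delta>_def using A(1) d(2) that by (rule log_deriv_closed)
  have leibniz: "(\<Sum>k\<le>n. \<Sum>i\<le>n - k. J (\<delta> k (d i x)) (d (n - k - i) y) + J (d i x) (\<delta> k (d (n - k - i) y))) =
      real n *\<^sub>R (\<Sum>i\<le>n. J (d i x) (d (n - i) y))" if "x \<in> A" "y \<in> A" for n x y
    unfolding \<delta>_def by (rule sum_log_deriv_leibniz) (simp_all add: J d(3) that)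
  have \<delta>_deriv: "jordan_defect J (\<delta> n) x y = 0" if "x \<in> A" "y \<in> A" for n x y
    using that
  proof (induction n arbitrary: x y rule: less_induct)
    case (less n)
    have "jordan_defect J (\<delta> n) x y = 0" if xy: "x \<in> A" "y \<in> A" "P x y" for x y
    proof -
      \<comment> \<open>\<open>E k\<close> gathers defects of \<open>\<delta> k\<close>. For
        \<open>k < n\<close> the induction hypothesis must cover all of \<open>A\<close>, because
        the arguments \<open>d i x\<close> and \<open>d (n - k - i) y\<close> may violate
        \<open>P\<close>; for \<open>k = n\<close> only the defect at \<open>x\<close>,
        \<open>y\<close> survives.\<close>
      define E where "E k = (\<Sum>i\<le>n - k. jordan_defect J (\<delta> k) (d i x) (d (n - k - i) y))" for k
      have "real n *\<^sub>R (\<Sum>i\<le>n. J (d i x) (d (n - i) y)) = real n *\<^sub>R d n (J x y)"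
        using derivable[OF xy] by simp
      also have "\<dots> = (\<Sum>k\<le>n. \<delta> k (d (n - k) (J x y)))"
        unfolding \<delta>_def by (rule sum_log_deriv[symmetric]) (simp add: d A xy)
      also have "\<dots> = (\<Sum>k\<le>n. \<Sum>i\<le>n - k. \<delta> k (J (d i x) (d (n - k - i) y)))"
        by (simp add: derivable[OF xy] linear_sum[OF lin])
      finally have "(\<Sum>k\<le>n. \<Sum>i\<le>n - k. \<delta> k (J (d i x) (d (n - k - i) y))) -
          (\<Sum>k\<le>n. \<Sum>i\<le>n - k. J (\<delta> k (d i x)) (d (n - k - i) y) + J (d i x) (\<delta> k (d (n - k - i) y))) = 0"
        unfolding leibniz[OF xy(1,2)] by (simp only: right_minus_eq)
      then have "0 = (\<Sum>k\<le>n. E k)"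
        by (simp only: E_def jordan_defect_def diff_diff_eq sum_subtractf)
      also have "\<dots> = (\<Sum>k<n. E k) + E n"
        by (simp flip: lessThan_Suc_atMost)
      also have "(\<Sum>k<n. E k) = 0"
        unfolding E_def by (intro sum.neutral ballI) (simp add: less.IH d(2) xy)
      also have "E n = jordan_defect J (\<delta> n) x y"
        by (simp add: E_def d(3) xy)
      finally show ?thesis by simp
    qed
    from first_order[OF lin closed this less.prems] show ?case .
  qed
  have \<delta>_leibniz: "\<delta> n (J x y) = J (\<delta> n x) y + J x (\<delta> n y)" if "x \<in> A" "y \<in> A" for n x y
    using \<delta>_deriv[OF that, of n] unfolding jordan_defect_def diff_diff_eq right_minus_eq .
  show ?thesis
  proof (induction n rule: less_induct)
    case (less n)
    show ?case
    proof (cases "n = 0")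
      case True
      then show ?thesis by (simp add: d(3) A(2) xy)
    next
      case False
      \<comment> \<open>This removes the term k = 0, the only one containing
        \<open>d n (J x y)\<close> itself, so the induction hypothesis suffices.\<close>
      have \<delta>0: "\<delta> 0 z = 0" for z
        unfolding \<delta>_def by (subst log_deriv.simps) simp
      have "real n *\<^sub>R d n (J x y) = (\<Sum>k\<le>n. \<delta> k (d (n - k) (J x y)))"
        unfolding \<delta>_def by (rule sum_log_deriv[symmetric]) (simp add: d A xy)
      also have "\<dots> = (\<Sum>k\<le>n. \<Sum>i\<le>n - k. \<delta> k (J (d i x) (d (n - k - i) y)))"
      proof (rule sum.cong[OF refl])
        fix k assume "k \<in> {..n}"
        show "\<delta> k (d (n - k) (J x y)) = (\<Sum>i\<le>n - k. \<delta> k (J (d i x) (d (n - k - i) y)))"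
        proof (cases "k = 0")
          case False
          with \<open>n \<noteq> 0\<close> have "n - k < n" by simp
          then show ?thesis by (simp only: less linear_sum[OF lin])
        qed (simp add: \<delta>0)
      qed
      also have "\<dots> = (\<Sum>k\<le>n. \<Sum>i\<le>n - k. J (\<delta> k (d i x)) (d (n - k - i) y) + J (d i x) (\<delta> k (d (n - k - i) y)))"
        by (simp add: \<delta>_leibniz d(2) xy)
      also have "\<dots> = real n *\<^sub>R (\<Sum>i\<le>n. J (d i x) (d (n - i) y))"
        by (rule leibniz[OF xy])
      finally show ?thesis using False by simp
    qed
  qed
qed

section \<open>Bounded functionals and rank-one operators\<close>

text \<open>Zorn's lemma is applied to graphs \<open>G \<subseteq> 'a \<times> \<real>\<close> of functionals dominated by the norm; the
  one-sided bound already makes such a subspace single-valued.\<close>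

lemma exists_norm_dominated_graph:
  fixes x :: "'a::real_normed_vector"
  obtains G :: "('a \<times> real) set"
    where "subspace G" "\<And>v r. (v, r) \<in> G \<Longrightarrow> r \<le> norm v" "(x, norm x) \<in> G" "\<And>v. \<exists>r. (v, r) \<in> G"
proof -
  define \<G> where "\<G> = {G :: ('a \<times> real) set. subspace G \<and> (\<forall>(v, r)\<in>G. r \<le> norm v) \<and> (x, norm x) \<in> G}"
  \<comment> \<open>Zorn's lemma starts from the line through \<open>(x, norm x)\<close>.\<close>
  have "r \<le> norm v" if "(v, r) \<in> span {(x, norm x)}" for v r
    using that by (auto simp: span_singleton intro: mult_right_mono[OF abs_ge_self norm_ge_zero])
  then have "span {(x, norm x)} \<in> \<G>"
    by (auto simp: \<G>_def span_base)
  then have "\<G> \<noteq> {}" by auto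
  moreover have "\<Union>\<C> \<in> \<G>" if \<C>: "\<C> \<noteq> {}" "subset.chain \<G> \<C>" for \<C>
  proof -
    have sub: "\<C> \<subseteq> \<G>" and chain: "\<And>G H. G \<in> \<C> \<Longrightarrow> H \<in> \<C> \<Longrightarrow> G \<subseteq> H \<or> H \<subseteq> G"
      using \<C>(2) by (auto simp: subset_chain_def)
    have "subspace (\<Union>\<C>)"
    proof (rule subspaceI)
      show "0 \<in> \<Union>\<C>" using \<C>(1) sub unfolding \<G>_def by (blast dest: subspace_0)
      show "a + b \<in> \<Union>\<C>" if "a \<in> \<Union>\<C>" "b \<in> \<Union>\<C>" for a b
      proof -
        obtain G H where GH: "G \<in> \<C>" "H \<in> \<C>" "a \<in> G" "b \<in> H" using \<open>a \<in> _\<close> \<open>b \<in> _\<close> by auto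
        then obtain K where "K \<in> \<C>" "a \<in> K" "b \<in> K" using chain by blast
        moreover have "subspace K" using \<open>K \<in> \<C>\<close> sub by (auto simp: \<G>_def)
        ultimately show ?thesis using subspace_add by blast
      qed
      show "c *\<^sub>R a \<in> \<Union>\<C>" if "a \<in> \<Union>\<C>" for c a
        using that sub by (auto simp: \<G>_def dest: subspace_scale)
    qed
    then show ?thesis using \<C>(1) sub by (fastforce simp: \<G>_def)
  qed
  ultimately obtain G where G: "G \<in> \<G>" and max: "\<And>H. H \<in> \<G> \<Longrightarrow> G \<subseteq> H \<Longrightarrow> H = G"
    using subset_Zorn_nonempty[of \<G>] by blast
  have sub: "subspace G" and le: "\<And>v r. (v, r) \<in> G \<Longrightarrow> r \<le> norm v" and x: "(x, norm x) \<in> G"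
    using G by (auto simp: \<G>_def)
  have "\<exists>r. (v, r) \<in> G" for v
  proof -
    \<comment> \<open>The value to assign to \<open>v\<close>: by the triangle inequality each r -
      norm (u - v) lies below each norm (w + v) - s, and the supremum of the former fits
      between.\<close>
    define c where "c = (SUP (u, r)\<in>G. r - norm (u - v))"
    have gap: "r - norm (u - v) \<le> norm (w + v) - s" if "(u, r) \<in> G" "(w, s) \<in> G" for u r w s
    proof -
      have "r + s \<le> norm (u + w)"
        using le[of "u + w" "r + s"] subspace_add[OF sub that] by simp
      also have "\<dots> \<le> norm (u - v) + norm (w + v)"
        using norm_triangle_ineq[of "u - v" "w + v"] by simp
      finally show ?thesis by simp
    qed
    have lower: "r - norm (u - v) \<le> c" if "(u, r) \<in> G" for u r
    proof -
      have "bdd_above ((\<lambda>(u, r). r - norm (u - v)) ` G)"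
        using gap[OF _ x] by (auto intro!: bdd_aboveI2)
      from cSUP_upper[OF that this] show ?thesis by (simp add: c_def)
    qed
    have upper: "c \<le> norm (w + v) - s" if "(w, s) \<in> G" for w s
      unfolding c_def using gap[OF _ that] x by (intro cSUP_least) auto
    define H where "H = {g + h | g h. g \<in> G \<and> h \<in> span {(v, c)}}"
    have "s \<le> norm w" if ws: "(w, s) \<in> H" for w s
    proof -
      obtain g h where gh: "g \<in> G" "h \<in> span {(v, c)}" "(w, s) = g + h"
        using ws unfolding H_def by blast
      obtain u r where g: "g = (u, r)" by (cases g)
      with gh have ur: "(u, r) \<in> G" by simp
      from gh obtain t where "h = t *\<^sub>R (v, c)"
        by (auto simp: span_singleton)
      then have w: "w = u + t *\<^sub>R v" "s = r + t * c"
        using gh g by simp_all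
      \<comment> \<open>Rescaling by the size of \<open>t\<close> reduces the bound to
        \<open>upper\<close> for t > 0 and to \<open>lower\<close> for t < 0.\<close>
      have scaled: "((1/k) *\<^sub>R u, r / k) \<in> G" for k
        using subspace_scale[OF sub ur, of "1/k"] by simp
      consider "t = 0" | "t > 0" | "t < 0" by linarith
      then show ?thesis
      proof cases
        case 1
        then show ?thesis using le ur w by simp
      next
        case 2
        have "t * c \<le> t * (norm ((1/t) *\<^sub>R u + v) - r / t)"
          using upper[OF scaled[of t]] 2 by simp
        also have "\<dots> = norm (t *\<^sub>R ((1/t) *\<^sub>R u + v)) - r"
          using 2 by (simp add: right_diff_distrib)
        finally show ?thesis using 2 w by (simp add: scaleR_add_right)
      next
        case 3
        define k where "k = - t"
        have k: "k > 0" "w = u - k *\<^sub>R v" "s = r - k * c" using 3 w by (simp_all add: k_def)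
        have "k * (r / k - norm ((1/k) *\<^sub>R u - v)) \<le> k * c"
          using lower[OF scaled[of k]] k(1) by (intro mult_left_mono) auto
        moreover have "k * norm ((1/k) *\<^sub>R u - v) = norm (k *\<^sub>R ((1/k) *\<^sub>R u - v))"
          using k(1) by simp
        moreover have "k *\<^sub>R ((1/k) *\<^sub>R u - v) = w"
          using k by (simp add: scaleR_diff_right)
        ultimately show ?thesis using k by (simp add: right_diff_distrib)
      qed
    qed
    moreover have "subspace H"
      unfolding H_def by (intro subspace_sums sub subspace_span)
    moreover have "G \<subseteq> H"
    proof
      fix g assume "g \<in> G"
      moreover have "g = g + 0" by simp
      ultimately show "g \<in> H" unfolding H_def using span_zero by blast
    qed
    ultimately have "H = G" using x by (intro max) (auto simp: \<G>_def)
    moreover have "0 + (v, c) \<in> H"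
      unfolding H_def using subspace_0[OF sub] span_base[of "(v, c)" "{(v, c)}"] by blast
    ultimately show ?thesis by auto
  qed
  with sub le x show thesis by (rule that)
qed

lemma exists_bounded_functional_nonzero:
  fixes x :: "'a::real_normed_vector"
  assumes "x \<noteq> 0"
  obtains f :: "'a \<Rightarrow> real" where "bounded_linear f" "f x \<noteq> 0"
proof -
  obtain G :: "('a \<times> real) set" where G: "subspace G" and le: "\<And>v r. (v, r) \<in> G \<Longrightarrow> r \<le> norm v"
    and x: "(x, norm x) \<in> G" and total: "\<And>v. \<exists>r. (v, r) \<in> G"
    using exists_norm_dominated_graph[of x] by blast
  have unique: "r = s" if "(v, r) \<in> G" "(v, s) \<in> G" for v r s
    using le[of 0 "r - s"] le[of 0 "s - r"] subspace_diff[OF G that] subspace_diff[OF G that(2,1)] by simp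
  obtain f where f: "\<And>v. (v, f v) \<in> G" using total by metis
  have "bounded_linear f"
  proof (rule bounded_linear_intro[where K = 1])
    show "f (a + b) = f a + f b" for a b
      using unique[OF f] subspace_add[OF G f[of a] f[of b]] by simp
    show "f (r *\<^sub>R a) = r *\<^sub>R f a" for r a
      using unique[OF f] subspace_scale[OF G f[of a], of r] by simp
    show "norm (f a) \<le> norm a * 1" for a
      using le[OF f[of a]] le[of "- a" "- f a"] subspace_neg[OF G f[of a]] by simp
  qed
  moreover have "f x \<noteq> 0" using unique[OF f x] assms by simp
  ultimately show thesis by (rule that)
qed

lemma exists_complex_functional:
  fixes x :: "'a::complex_normed_vector"
  assumes "x \<noteq> 0"
  obtains g :: "'a \<Rightarrow> complex" where "bounded_linear g" "\<And>c y. g (c *\<^sub>C y) = c * g y" "g x = 1"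
proof -
  obtain f :: "'a \<Rightarrow> real" where f: "bounded_linear f" "f x \<noteq> 0"
    using exists_bounded_functional_nonzero[OF assms] .
  interpret f: bounded_linear f by fact
  \<comment> \<open>The standard complexification: \<open>h\<close> is complex-linear with real part
    \<open>f\<close>, so \<open>h x\<close> is nonzero and can be normalized to 1.\<close>
  define h where "h y = complex_of_real (f y) - \<i> * complex_of_real (f (\<i> *\<^sub>C y))" for y
  have "bounded_linear h"
    unfolding h_def
    by (intro bounded_linear_sub bounded_linear_const_mult bounded_linear_compose[OF bounded_linear_of_real]
        f bounded_linear_compose[OF f(1)] bounded_linear_scaleC_right)
  have split: "c *\<^sub>C y = Re c *\<^sub>R y + Im c *\<^sub>R (\<i> *\<^sub>C y)" for c and y :: 'a
  proof -
    have "c *\<^sub>C y = (complex_of_real (Re c) + complex_of_real (Im c) * \<i>) *\<^sub>C y"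
      by (simp add: complex_eq mult.commute flip: complex_eq)
    then show ?thesis by (simp add: scaleC_add_left scaleC_of_real flip: scaleC_scaleC)
  qed
  have "\<i> *\<^sub>C \<i> *\<^sub>C y = - y" for y :: 'a
    using scaleC_of_real[of "-1" y] by (simp add: scaleC_scaleC)
  then have h: "h (c *\<^sub>C y) = c * h y" for c y
    unfolding h_def split[of c y]
    by (simp add: complex_eq_iff scaleC_add_right f.add f.scaleR f.neg f.diff scaleC_scaleC
        linear_cmul[OF bounded_linear.linear[OF bounded_linear_scaleC_right]] algebra_simps)
  have "h x \<noteq> 0" using f(2) by (simp add: h_def complex_eq_iff)
  show thesis
  proof (rule that)
    show "bounded_linear (\<lambda>y. h y / h x)"
      using \<open>bounded_linear h\<close> by (rule bounded_linear_compose[OF bounded_linear_divide])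
  qed (use h \<open>h x \<noteq> 0\<close> in auto)
qed

lemma rank_one_operator:
  fixes g :: "'a::complex_normed_vector \<Rightarrow> complex"
  assumes "bounded_linear g" "\<And>c y. g (c *\<^sub>C y) = c * g y"
  obtains T where "T \<in> bounded_operators" "\<And>x. blinfun_apply T x = g x *\<^sub>C y"
proof
  have "bounded_linear (\<lambda>c. c *\<^sub>C y)"
    by (rule bounded_linear_intro[where K = "norm y"])
      (simp_all add: scaleC_add_left norm_scaleC scaleR_conv_of_real scaleC_of_real flip: scaleC_scaleC)
  then have "bounded_linear (\<lambda>x. g x *\<^sub>C y)"
    using assms(1) by (rule bounded_linear_compose)
  then show *: "blinfun_apply (Blinfun (\<lambda>x. g x *\<^sub>C y)) x = g x *\<^sub>C y" for x
    by (simp add: bounded_linear_Blinfun_apply)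
  show "Blinfun (\<lambda>x. g x *\<^sub>C y) \<in> bounded_operators"
    by (simp add: bounded_operators_def * assms(2) scaleC_scaleC)
qed

section \<open>Extension of linear maps and the Neumann series\<close>

text \<open>\<open>linear_maps\<close> constrains values on the algebra only, whereas the abstract
  results concern maps linear on the whole type; this bridges the two.\<close>

lemma linear_extension_from_subspace:
  fixes f :: "'b::real_vector \<Rightarrow> 'c::real_vector"
  assumes V: "subspace V" and add: "\<And>x y. x \<in> V \<Longrightarrow> y \<in> V \<Longrightarrow> f (x + y) = f x + f y"
    and scale: "\<And>r x. x \<in> V \<Longrightarrow> f (r *\<^sub>R x) = r *\<^sub>R f x"
  obtains g where "linear g" "\<And>x. x \<in> V \<Longrightarrow> g x = f x"
proof -
  obtain B where B: "B \<subseteq> V" "independent B" "V \<subseteq> span B"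
    using maximal_independent_subset[of V] by blast
  obtain g where g: "linear g" "\<forall>x\<in>B. g x = f x"
    using linear_independent_extend[OF B(2)] by blast
  have "x \<in> V \<and> g x = f x" if "x \<in> span B" for x
    using that
  proof (induction rule: span_induct_alt)
    case base
    show ?case using subspace_0[OF V] scale[of 0 0] linear_0[OF g(1)] by simp
  next
    case (step c x y)
    then have "x \<in> V" using B(1) by blast
    with step g show ?case
      by (simp add: add scale V subspace_add subspace_scale linear_add linear_cmul)
  qed
  with B(3) show thesis by (intro that[OF g(1)]) auto
qed

lemma blinfun_compose_assoc: "(a o\<^sub>L b) o\<^sub>L c = a o\<^sub>L (b o\<^sub>L c)"
  by (rule blinfun_eqI) simp

text \<open>Neumann series: the powers of x / r are summable for \<open>r\<close> above the norm of
  \<open>x\<close>, and closedness keeps the limit of the partial sums in \<open>A\<close>.\<close>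

lemma resolvent_in_closed_subalgebra:
  fixes x :: "'a::banach \<Rightarrow>\<^sub>L 'a"
  assumes A: "subspace A" "closed A" "id_blinfun \<in> A" "\<And>x y. x \<in> A \<Longrightarrow> y \<in> A \<Longrightarrow> x o\<^sub>L y \<in> A"
    and x: "x \<in> A"
  shows "\<exists>r. \<exists>y\<in>A. (r *\<^sub>R id_blinfun - x) o\<^sub>L y = id_blinfun \<and> y o\<^sub>L (r *\<^sub>R id_blinfun - x) = id_blinfun"
proof -
  \<comment> \<open>The added 1 makes \<open>r\<close> positive and the ratio \<open>q\<close>
    strictly less than 1, also for \<open>x = 0\<close>.\<close>
  define r where "r = norm x + 1"
  define u where "u = (1/r) *\<^sub>R x"
  define q where "q = norm x / r"
  have r: "r > 0" and q: "0 \<le> q" "q < 1" by (simp_all add: r_def q_def add_nonneg_pos)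
  define w where "w n = ((\<lambda>z. u o\<^sub>L z) ^^ n) id_blinfun" for n
  have w0: "w 0 = id_blinfun" and wS: "w (Suc n) = u o\<^sub>L w n" for n by (simp_all add: w_def)
  have wS': "w n o\<^sub>L u = w (Suc n)" for n
    by (induction n) (simp_all add: w0 wS blinfun_eqI blinfun_compose_assoc)
  have wA: "w n \<in> A" for n
    by (induction n) (simp_all add: w0 wS A x u_def subspace_scale)
  have "norm (w n) \<le> q ^ n" for n
  proof (induction n)
    case 0
    show ?case by (simp add: w0 norm_blinfun_id_le)
  next
    case (Suc n)
    have "norm (w (Suc n)) \<le> norm u * norm (w n)" unfolding wS by (rule norm_blinfun_compose)
    also have "norm u = q" using r by (simp add: u_def q_def)
    also have "q * norm (w n) \<le> q * q ^ n" using Suc q by (intro mult_left_mono)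
    finally show ?case by simp
  qed
  then have summable: "summable w"
    using q by (intro summable_comparison_test'[OF summable_geometric[of q]]) auto
  define y where "y = suminf w"
  have "(\<Sum>i<n. w i) \<in> A" for n
    using wA by (rule subspace_sum[OF A(1)])
  moreover have "(\<lambda>n. \<Sum>i<n. w i) \<longlonglongrightarrow> y"
    using summable unfolding y_def by (rule summable_LIMSEQ)
  ultimately have "y \<in> A" by (rule closed_sequentially[OF A(2)])
  have shift: "(\<Sum>n. w (Suc n)) = y - id_blinfun"
    using suminf_split_head[OF summable] by (simp add: y_def w0)
  have uy: "u o\<^sub>L y = y - id_blinfun"
    using bounded_linear.suminf[OF bounded_bilinear.bounded_linear_right[OF bounded_bilinear_blinfun_compose] summable, of u]
    by (simp add: y_def shift flip: wS)
  have yu: "y o\<^sub>L u = y - id_blinfun"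
    using bounded_linear.suminf[OF bounded_bilinear.bounded_linear_left[OF bounded_bilinear_blinfun_compose] summable, of u]
    by (simp add: y_def shift wS')
  have x: "x = r *\<^sub>R u" using r by (simp add: u_def)
  have id: "id_blinfun o\<^sub>L z = z" "z o\<^sub>L id_blinfun = z" for z :: "'a \<Rightarrow>\<^sub>L 'a"
    by (simp_all add: blinfun_eqI)
  note simps = id bounded_bilinear.diff_left[OF bounded_bilinear_blinfun_compose] bounded_bilinear.diff_right[OF bounded_bilinear_blinfun_compose]
    bounded_bilinear.scaleR_left[OF bounded_bilinear_blinfun_compose] bounded_bilinear.scaleR_right[OF bounded_bilinear_blinfun_compose]
  show ?thesis
  proof (intro exI bexI conjI)
    show "(r *\<^sub>R id_blinfun - x) o\<^sub>L ((1/r) *\<^sub>R y) = id_blinfun"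
      using r by (simp add: x simps uy scaleR_diff_right)
    show "((1/r) *\<^sub>R y) o\<^sub>L (r *\<^sub>R id_blinfun - x) = id_blinfun"
      using r by (simp add: x simps yu scaleR_diff_right)
    show "(1/r) *\<^sub>R y \<in> A" using \<open>y \<in> A\<close> A(1) by (simp add: subspace_scale)
  qed
qed

section \<open>The algebra of a subspace lattice\<close>

lemma bilinear_blinfun_compose: "bilinear (o\<^sub>L)"
  unfolding bilinear_def
  by (auto intro: bounded_linear.linear bounded_bilinear.bounded_linear_left
      bounded_bilinear.bounded_linear_right bounded_bilinear_blinfun_compose)

lemma id_blinfun_compose: "id_blinfun o\<^sub>L T = T" "T o\<^sub>L id_blinfun = T"
  by (simp_all add: blinfun_eqI)

lemma scaleC_scaleR_commute: "c *\<^sub>C r *\<^sub>R x = r *\<^sub>R c *\<^sub>C (x :: 'a::complex_normed_vector)"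
  by (simp add: linear_cmul[OF bounded_linear.linear[OF bounded_linear_scaleC_right]])

lemma bounded_operatorsD:
  "T \<in> bounded_operators \<Longrightarrow> blinfun_apply T (c *\<^sub>C x) = c *\<^sub>C blinfun_apply T x"
  by (simp add: bounded_operators_def)

lemma algD:
  assumes "T \<in> alg L"
  shows "T \<in> bounded_operators" and "M \<in> L \<Longrightarrow> x \<in> M \<Longrightarrow> blinfun_apply T x \<in> M"
  using assms unfolding alg_def by blast+

lemma subspace_lattice_member:
  assumes "subspace_lattice L" "M \<in> L"
  shows "closed M" and "subspace M"
proof -
  have M: "complex_vector.subspace M" "closed M"
    using assms by (auto simp: subspace_lattice_def)
  show "closed M" by fact
  show "subspace M"
    using complex_vector.subspace_0[OF M(1)] complex_vector.subspace_add[OF M(1)]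
      complex_vector.subspace_scale[OF M(1)] by (auto intro!: subspaceI simp flip: scaleC_of_real)
qed

lemma alg_subspace:
  assumes "subspace_lattice L"
  shows "subspace (alg L)"
  using subspace_lattice_member(2)[OF assms] unfolding alg_def bounded_operators_def image_subset_iff
  by (auto intro!: subspaceI simp: blinfun.bilinear_simps scaleC_add_right scaleC_scaleR_commute
      subspace_0 subspace_add subspace_scale)

lemma alg_closed:
  fixes L :: "'a::complex_normed_vector set set"
  assumes "subspace_lattice L"
  shows "closed (alg L)"
proof -
  have "alg L = (\<Inter>c. \<Inter>x. {T. blinfun_apply T (c *\<^sub>C x) = c *\<^sub>C blinfun_apply T x}) \<inter>
      (\<Inter>M\<in>L. \<Inter>x\<in>M. (\<lambda>T. blinfun_apply T x) -` M)"
    unfolding alg_def bounded_operators_def image_subset_iff by auto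
  moreover have "closed {T :: 'a \<Rightarrow>\<^sub>L 'a. blinfun_apply T (c *\<^sub>C x) = c *\<^sub>C blinfun_apply T x}" for c x
    by (intro closed_Collect_eq continuous_intros
        bounded_linear.continuous_on[OF bounded_linear_scaleC_right])
  moreover have "closed ((\<lambda>T :: 'a \<Rightarrow>\<^sub>L 'a. blinfun_apply T x) -` M)" if "M \<in> L" for M x
    by (intro closed_vimage subspace_lattice_member(1)[OF assms that] continuous_intros)
  ultimately show ?thesis by (auto intro!: closed_Int closed_INT)
qed

lemma alg_compose: "S \<in> alg L \<Longrightarrow> T \<in> alg L \<Longrightarrow> S o\<^sub>L T \<in> alg L"
  by (auto simp: alg_def bounded_operators_def image_subset_iff)

lemma id_in_alg: "id_blinfun \<in> alg L"
  by (auto simp: alg_def bounded_operators_def)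

text \<open>Triangularity is the invariance of ran P. The faithfulness and torsion axioms are tested
  on P T (I - P) with T of rank one, which \<open>full\<close> places in
  \<open>alg L\<close>.\<close>

lemma triangular_algebra_alg:
  fixes L :: "'a::complex_banach set set"
  assumes L: "subspace_lattice L" and P: "P \<in> alg L" "nontrivial_idempotent P"
    and ran: "range (blinfun_apply P) \<in> L"
    and full: "{P o\<^sub>L T o\<^sub>L (id_blinfun - P) | T. T \<in> bounded_operators} \<subseteq> alg L"
  shows "triangular_algebra (o\<^sub>L) (alg L) id_blinfun P"
proof -
  have PP: "P o\<^sub>L P = P" and P_nonzero: "P \<noteq> 0" "P \<noteq> id_blinfun"
    using P(2) by (auto simp: nontrivial_idempotent_def)
  have PPx: "P (P x) = P x" for x
    using PP by (metis blinfun_apply_blinfun_compose)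
  have apply_eq: "S (T x) = U x" if "S o\<^sub>L T = U" for S T U :: "'a \<Rightarrow>\<^sub>L 'a" and x
    using that by (metis blinfun_apply_blinfun_compose)
  \<comment> \<open>A nonzero kernel vector of \<open>P\<close> exists since \<open>P\<close> is not
    the identity.\<close>
  obtain w where w: "w \<noteq> 0" "P w = 0"
  proof -
    obtain u where "P u \<noteq> u"
      using P_nonzero(2) by (metis blinfun_apply_id_blinfun blinfun_eqI)
    then show thesis
      by (intro that[of "u - P u"]) (auto simp: blinfun.bilinear_simps PPx)
  qed
  have rank_one: "\<exists>s\<in>alg L. P o\<^sub>L s = s \<and> s o\<^sub>L P = 0 \<and> (\<forall>x. P x = 0 \<longrightarrow> s x = g x *\<^sub>C P y)"
    if g: "bounded_linear g" "\<And>c x. g (c *\<^sub>C x) = c * g x" for g y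
  proof -
    obtain T where T: "T \<in> bounded_operators" "\<And>x. blinfun_apply T x = g x *\<^sub>C y"
      using rank_one_operator[OF g] by metis
    define s where "s = P o\<^sub>L T o\<^sub>L (id_blinfun - P)"
    have "s \<in> alg L" using full T(1) unfolding s_def by blast
    moreover have "P o\<^sub>L s = s" by (rule blinfun_eqI) (simp add: s_def PPx)
    moreover have "s o\<^sub>L P = 0" by (rule blinfun_eqI) (simp add: s_def PPx blinfun.bilinear_simps)
    moreover have "s x = g x *\<^sub>C P y" if "P x = 0" for x
      using that bounded_operatorsD[OF algD(1)[OF P(1)]]
      by (simp add: s_def T(2) blinfun.bilinear_simps)
    ultimately show ?thesis by blast
  qed
  obtain g\<^sub>w where g\<^sub>w: "bounded_linear g\<^sub>w" "\<And>c x. g\<^sub>w (c *\<^sub>C x) = c * g\<^sub>w x" "g\<^sub>w w = 1"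
    using exists_complex_functional[OF w(1)] by blast
  show ?thesis
  proof
    show "bilinear (o\<^sub>L)" by (rule bilinear_blinfun_compose)
    show "subspace (alg L)" using L by (rule alg_subspace)
    show "x o\<^sub>L y \<in> alg L" if "x \<in> alg L" "y \<in> alg L" for x y using that by (rule alg_compose)
    show "\<exists>r. \<exists>y\<in>alg L. r *\<^sub>R id_blinfun - x o\<^sub>L y = id_blinfun \<and> y o\<^sub>L r *\<^sub>R id_blinfun - x = id_blinfun"
      if "x \<in> alg L" for x
      using resolvent_in_closed_subalgebra[OF alg_subspace[OF L] alg_closed[OF L] id_in_alg alg_compose that] .
    show "P o\<^sub>L (T o\<^sub>L P) = T o\<^sub>L P" if "T \<in> alg L" for T
    proof (rule blinfun_eqI)
      fix x
      have "T (P x) \<in> range (blinfun_apply P)" by (rule algD(2)[OF that ran]) simp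
      then show "(P o\<^sub>L (T o\<^sub>L P)) x = (T o\<^sub>L P) x" by (auto simp: PPx)
    qed
    show "a = 0"
      if a: "a \<in> {x \<in> alg L. P o\<^sub>L x = x \<and> x o\<^sub>L P = x}"
        and zero: "\<And>s. s \<in> {x \<in> alg L. P o\<^sub>L x = x \<and> x o\<^sub>L P = 0} \<Longrightarrow> a o\<^sub>L s = 0" for a
    proof (rule blinfun_eqI)
      fix y
      \<comment> \<open>As \<open>g\<^sub>w w = 1\<close>, this \<open>s\<close> sends
        \<open>w\<close> to \<open>P y\<close>, so \<open>a o\<^sub>L s = 0\<close> yields
        \<open>a (P y) = 0\<close>.\<close>
      obtain s where s: "s \<in> alg L" "P o\<^sub>L s = s" "s o\<^sub>L P = 0" "s w = P y"
        using rank_one[OF g\<^sub>w(1,2), of y] g\<^sub>w(3) w(2) by auto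
      have "a (s w) = 0" using apply_eq[OF zero[of s], of w] s by simp
      moreover have "a (P y) = a y" using apply_eq[of a P a] a by simp
      ultimately show "a y = blinfun_apply 0 y" using s(4) by simp
    qed
    show "b = 0"
      if b: "b \<in> {x \<in> alg L. P o\<^sub>L x = 0 \<and> x o\<^sub>L P = 0}"
        and zero: "\<And>s. s \<in> {x \<in> alg L. P o\<^sub>L x = x \<and> x o\<^sub>L P = 0} \<Longrightarrow> s o\<^sub>L b = 0" for b
    proof (rule ccontr)
      assume "b \<noteq> 0"
      then obtain v where v: "b v \<noteq> 0" by (metis blinfun_eqI zero_blinfun.rep_eq)
      obtain y where y: "P y \<noteq> 0" using P_nonzero(1) by (metis blinfun_eqI zero_blinfun.rep_eq)
      \<comment> \<open>\<open>b v\<close> lies in the kernel of \<open>P\<close>, so a functional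
        normalized there gives \<open>s (b v) = P y\<close>, contradicting
        \<open>s o\<^sub>L b = 0\<close>.\<close>
      obtain g where g: "bounded_linear g" "\<And>c x. g (c *\<^sub>C x) = c * g x" "g (b v) = 1"
        using exists_complex_functional[OF v] by blast
      have "P (b v) = 0" using apply_eq[of P b 0 v] b by simp
      then obtain s where s: "s \<in> alg L" "P o\<^sub>L s = s" "s o\<^sub>L P = 0" "s (b v) = P y"
        using rank_one[OF g(1,2), of y] g(3) by auto
      then show False using apply_eq[OF zero[of s], of v] y by simp
    qed
    show "a = 0"
      if a: "a \<in> {x \<in> alg L. P o\<^sub>L x = x \<and> x o\<^sub>L P = x}"
        and b: "b \<in> {x \<in> alg L. P o\<^sub>L x = 0 \<and> x o\<^sub>L P = 0}"
        and comm: "\<And>s. s \<in> {x \<in> alg L. P o\<^sub>L x = x \<and> x o\<^sub>L P = 0} \<Longrightarrow> a o\<^sub>L s = s o\<^sub>L b"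
        and t: "t \<in> {x \<in> alg L. P o\<^sub>L x = x \<and> x o\<^sub>L P = 0}" "a o\<^sub>L t = 0" "t \<noteq> 0" for a b t
    proof -
      \<comment> \<open>Evaluating \<open>a o\<^sub>L s = s o\<^sub>L b\<close> at \<open>w\<close>
        shows that \<open>a\<close> is a multiple of \<open>P\<close>. Since \<open>P\<close> fixes
        the range of \<open>t\<close>, a t = 0 with t nonzero makes the scalar zero.\<close>
      have scalar: "a y = g\<^sub>w (b w) *\<^sub>C P y" for y
      proof -
        have "P (b w) = 0" using apply_eq[of P b 0 w] b by simp
        then obtain s where s: "s \<in> alg L" "P o\<^sub>L s = s" "s o\<^sub>L P = 0" "s w = P y"
            "s (b w) = g\<^sub>w (b w) *\<^sub>C P y"
          using rank_one[OF g\<^sub>w(1,2), of y] g\<^sub>w(3) w(2) by auto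
        have "a (P y) = a y" using apply_eq[of a P a] a by simp
        moreover have "a (s w) = s (b w)"
          using comm[of s] s by (metis (mono_tags, lifting) blinfun_apply_blinfun_compose mem_Collect_eq)
        ultimately show ?thesis using s by simp
      qed
      obtain z where z: "t z \<noteq> 0" using t(3) by (metis blinfun_eqI zero_blinfun.rep_eq)
      have "P (t z) = t z" using apply_eq[of P t t z] t(1) by simp
      then have "g\<^sub>w (b w) *\<^sub>C t z = 0"
        using scalar[of "t z"] apply_eq[OF t(2), of z] by simp
      then have "g\<^sub>w (b w) = 0"
        using z by simp
      then show "a = 0" by (intro blinfun_eqI) (simp add: scalar)
    qed
  qed (simp_all add: blinfun_compose_assoc id_blinfun_compose id_in_alg P(1) PP P_nonzero)
qed

section \<open>From the first-order result to Jordan higher derivations\<close>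

text \<open>Reflecting i to n - i in the second half makes each summand the Jordan product of
  \<open>d i A\<close> and \<open>d (n - i) B\<close>.\<close>

lemma jordan_higher_identity_iff:
  "jordan_higher_identity d A B \<longleftrightarrow>
    (\<forall>n. d n ((A o\<^sub>L B) + (B o\<^sub>L A)) =
      (\<Sum>i\<le>n. (d i A o\<^sub>L d (n - i) B) + (d (n - i) B o\<^sub>L d i A)))"
proof -
  have "(\<Sum>(i, j) | i + j = n. (d i A o\<^sub>L d j B) + (d i B o\<^sub>L d j A)) =
      (\<Sum>i\<le>n. (d i A o\<^sub>L d (n - i) B) + (d (n - i) B o\<^sub>L d i A))" for n
  proof -
    have "(\<Sum>(i, j) | i + j = n. (d i A o\<^sub>L d j B) + (d i B o\<^sub>L d j A)) =
        (\<Sum>i\<le>n. (d i A o\<^sub>L d (n - i) B) + (d i B o\<^sub>L d (n - i) A))"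
      by (rule sum.reindex_bij_witness[where i = "\<lambda>i. (i, n - i)" and j = fst]) auto
    also have "(\<Sum>i\<le>n. (d i A o\<^sub>L d (n - i) B) + (d i B o\<^sub>L d (n - i) A)) =
        (\<Sum>i\<le>n. d i A o\<^sub>L d (n - i) B) + (\<Sum>i\<le>n. d i B o\<^sub>L d (n - i) A)"
      by (rule sum.distrib)
    also have "(\<Sum>i\<le>n. d i B o\<^sub>L d (n - i) A) = (\<Sum>i\<le>n. d (n - i) B o\<^sub>L d i A)"
      by (rule sum.reindex_bij_witness[where i = "\<lambda>i. n - i" and j = "\<lambda>i. n - i"]) auto
    finally show ?thesis by (simp only: sum.distrib)
  qed
  then show ?thesis by (simp only: jordan_higher_identity_def)
qed

theorem corollary3p6:
  fixes L :: "'a::complex_banach set set"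
  assumes "subspace_lattice L"
    and "\<exists>P\<in>alg L. nontrivial_idempotent P \<and> range (blinfun_apply P) \<in> L \<and>
           {P o\<^sub>L T o\<^sub>L (id_blinfun - P) | T. T \<in> bounded_operators} \<subseteq> alg L"
  shows "\<forall>C\<in>alg L. jordan_higher_all_derivable_point (alg L) C"
proof
  fix C assume C: "C \<in> alg L"
  obtain P where "triangular_algebra (o\<^sub>L) (alg L) id_blinfun P"
    using triangular_algebra_alg assms by blast
  then interpret triangular_algebra "(o\<^sub>L)" "alg L" id_blinfun P
    "{x \<in> alg L. P o\<^sub>L x = x \<and> x o\<^sub>L P = x}" "{x \<in> alg L. P o\<^sub>L x = x \<and> x o\<^sub>L P = 0}"
    "{x \<in> alg L. P o\<^sub>L x = 0 \<and> x o\<^sub>L P = 0}" .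
  have "jordan_higher_derivation (alg L) d" if d: "jordan_higher_derivable_at (alg L) d C" for d
  proof -
    have seq: "higher_sequence (alg L) d"
      and derivable: "\<And>A B. A \<in> alg L \<Longrightarrow> B \<in> alg L \<Longrightarrow> A o\<^sub>L B = C \<Longrightarrow> jordan_higher_identity d A B"
      using d by (auto simp: jordan_higher_derivable_at_def)
    have d_closed: "d n A \<in> alg L" if "A \<in> alg L" for n A
      using seq that by (auto simp: higher_sequence_def linear_maps_def)
    have jprod_closed: "jprod A B \<in> alg L" if "A \<in> alg L" "B \<in> alg L" for A B
      using that by (simp add: jprod_def mem_simps)
    have d_zero: "d 0 A = A" if "A \<in> alg L" for A
      using seq that by (auto simp: higher_sequence_def)
    \<comment> \<open>Each \<open>d n\<close> is replaced by a globally linear map that agrees with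
      it on \<open>alg L\<close>.\<close>
    have "\<exists>f. linear f \<and> (\<forall>A\<in>alg L. f A = d n A)" for n
    proof -
      have d_add: "d n (A + B) = d n A + d n B" if "A \<in> alg L" "B \<in> alg L" for A B
        using seq that by (simp add: higher_sequence_def linear_maps_def)
      have d_scale: "d n (r *\<^sub>R A) = r *\<^sub>R d n A" if "A \<in> alg L" for r A
        using seq that by (simp add: higher_sequence_def linear_maps_def flip: scaleC_of_real)
      show ?thesis using linear_extension_from_subspace[OF subspace d_add d_scale] by metis
    qed
    then obtain f where f: "\<And>n. linear (f n)" "\<And>n A. A \<in> alg L \<Longrightarrow> f n A = d n A"
      by metis
    have identity: "jordan_higher_identity d A B \<longleftrightarrow> (\<forall>n. f n (jprod A B) = (\<Sum>i\<le>n. jprod (f i A) (f (n - i) B)))"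
      if "A \<in> alg L" "B \<in> alg L" for A B
      using that by (simp add: jordan_higher_identity_iff jprod_def f(2) mem_simps)
    have "f n (jprod A B) = (\<Sum>i\<le>n. jprod (f i A) (f (n - i) B))" if "A \<in> alg L" "B \<in> alg L" for n A B
    \<comment> \<open>The \<open>P\<close> instantiated here is the predicate of that lemma, not the
      idempotent.\<close>
    proof (rule higher_derivable_everywhere[where J = jprod and d = f and A = "alg L" and P = "\<lambda>A B. A o\<^sub>L B = C"])
      fix \<delta> x y
      assume \<delta>: "linear \<delta>" "\<And>x. x \<in> alg L \<Longrightarrow> \<delta> x \<in> alg L"
        "\<And>x y. x \<in> alg L \<Longrightarrow> y \<in> alg L \<Longrightarrow> x o\<^sub>L y = C \<Longrightarrow> jordan_defect jprod \<delta> x y = 0"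
        and xy: "x \<in> alg L" "y \<in> alg L"
      then show "jordan_defect jprod \<delta> x y = 0"
        using jordan_derivation_of_jordan_derivable[OF _ _ C] by blast
    next
      show "f n (jprod A B) = (\<Sum>i\<le>n. jprod (f i A) (f (n - i) B))"
        if "A \<in> alg L" "B \<in> alg L" "A o\<^sub>L B = C" for n A B
        using derivable[OF that] identity[OF that(1,2)] by simp
    qed (use that in \<open>simp_all add: bilinear_jprod subspace f d_closed d_zero jprod_closed\<close>)
    then show ?thesis using seq identity by (simp add: jordan_higher_derivation_def)
  qed
  then show "jordan_higher_all_derivable_point (alg L) C"
    using C by (simp add: jordan_higher_all_derivable_point_def)
qed

end
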